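(* The adjunction $\mathcal O\dashv \mathrm{pt}$ between topological spaces and locales restricts to an adjoint equivalence between the category of LCS-complete spaces (resp. domain-complete spaces) with continuous maps and the opposite of the category (with frame homomorphisms) of quotient frames $L/{\preceq_A}$, where $L$ is a distributive continuous complete lattice (resp. a completely distributive complete lattice which is continuous) and $A$ is a countable subset of $L$.
   Context: $\mathcal O$ sends a space $X$ to its frame of open sets and a continuous $f$ to $U\mapsto f^{-1}(U)$; $\mathrm{pt}$ sends a frame $L$ to the set of completely prime filters of $L$ with open sets $\{x\mid u\in x\}$, $u\in L$. A congruence preorder on a frame $L$ is a transitive relation $\preceq$ with $u\le v\Rightarrow u\preceq v$, $\bigvee_i u_i\preceq v$ whenever all $u_i\preceq v$, and $u\preceq \bigwedge_{i=1}^n v_i$ whenever $u\preceq v_i$ for all $i\le n$; the quotient frame $L/{\preceq}$ consists of equivalence classes modulo $\preceq\cap\succeq$. For $A\subseteq L$, $\preceq_A$ is the least congruence preorder with $\top\preceq_A a$ for all $a\in A$. A space is domain-complete (resp. LCS-complete) if it is homeomorphic to a $G_\delta$ subset (countable intersection of open sets), with the subspace topology, of some continuous dcpo with its Scott topology (resp. of some locally compact sober space, locally compact meaning every point has a neighborhood base of compact saturated sets). *)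

theory Defs
  imports "HOL-Analysis.Analysis"
begin

definition partial_order_on' :: "'l set \<Rightarrow> ('l \<Rightarrow> 'l \<Rightarrow> bool) \<Rightarrow> bool" where
  "partial_order_on' C le \<longleftrightarrow>
     (\<forall>x\<in>C. le x x) \<and>
     (\<forall>x\<in>C. \<forall>y\<in>C. le x y \<and> le y x \<longrightarrow> x = y) \<and>
     (\<forall>x\<in>C. \<forall>y\<in>C. \<forall>z\<in>C. le x y \<and> le y z \<longrightarrow> le x z)"

definition is_lub :: "'l set \<Rightarrow> ('l \<Rightarrow> 'l \<Rightarrow> bool) \<Rightarrow> 'l set \<Rightarrow> 'l \<Rightarrow> bool" where
  "is_lub C le S x \<longleftrightarrow> x \<in> C \<and> (\<forall>s\<in>S. le s x) \<and> (\<forall>y\<in>C. (\<forall>s\<in>S. le s y) \<longrightarrow> le x y)"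

definition is_glb :: "'l set \<Rightarrow> ('l \<Rightarrow> 'l \<Rightarrow> bool) \<Rightarrow> 'l set \<Rightarrow> 'l \<Rightarrow> bool" where
  "is_glb C le S x \<longleftrightarrow> x \<in> C \<and> (\<forall>s\<in>S. le x s) \<and> (\<forall>y\<in>C. (\<forall>s\<in>S. le y s) \<longrightarrow> le y x)"

definition lsup :: "'l set \<Rightarrow> ('l \<Rightarrow> 'l \<Rightarrow> bool) \<Rightarrow> 'l set \<Rightarrow> 'l" where
  "lsup C le S = (THE x. is_lub C le S x)"

definition linf :: "'l set \<Rightarrow> ('l \<Rightarrow> 'l \<Rightarrow> bool) \<Rightarrow> 'l set \<Rightarrow> 'l" where
  "linf C le S = (THE x. is_glb C le S x)"

definition complete_lattice_on :: "'l set \<Rightarrow> ('l \<Rightarrow> 'l \<Rightarrow> bool) \<Rightarrow> bool" where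
  "complete_lattice_on C le \<longleftrightarrow> partial_order_on' C le \<and> (\<forall>S\<subseteq>C. \<exists>x. is_lub C le S x)"

definition distributive_on :: "'l set \<Rightarrow> ('l \<Rightarrow> 'l \<Rightarrow> bool) \<Rightarrow> bool" where
  "distributive_on C le \<longleftrightarrow>
     (\<forall>a\<in>C. \<forall>b\<in>C. \<forall>c\<in>C.
        linf C le {a, lsup C le {b, c}} = lsup C le {linf C le {a, b}, linf C le {a, c}})"

definition completely_distributive_on :: "'l set \<Rightarrow> ('l \<Rightarrow> 'l \<Rightarrow> bool) \<Rightarrow> bool" where
  "completely_distributive_on C le \<longleftrightarrow>
     (\<forall>\<S>. \<S> \<subseteq> Pow C \<longrightarrow>
        linf C le (lsup C le ` \<S>) =
        lsup C le {linf C le (f ` \<S>) | f. \<forall>S\<in>\<S>. f S \<in> S})"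

definition directed_on :: "'l set \<Rightarrow> ('l \<Rightarrow> 'l \<Rightarrow> bool) \<Rightarrow> 'l set \<Rightarrow> bool" where
  "directed_on C le D \<longleftrightarrow> D \<noteq> {} \<and> D \<subseteq> C \<and> (\<forall>x\<in>D. \<forall>y\<in>D. \<exists>z\<in>D. le x z \<and> le y z)"

definition way_below :: "'l set \<Rightarrow> ('l \<Rightarrow> 'l \<Rightarrow> bool) \<Rightarrow> 'l \<Rightarrow> 'l \<Rightarrow> bool" where
  "way_below C le x y \<longleftrightarrow>
     (\<forall>D s. directed_on C le D \<and> is_lub C le D s \<and> le y s \<longrightarrow> (\<exists>d\<in>D. le x d))"

definition dcpo_on :: "'l set \<Rightarrow> ('l \<Rightarrow> 'l \<Rightarrow> bool) \<Rightarrow> bool" where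
  "dcpo_on C le \<longleftrightarrow> partial_order_on' C le \<and> (\<forall>D. directed_on C le D \<longrightarrow> (\<exists>x. is_lub C le D x))"

definition continuous_dcpo :: "'l set \<Rightarrow> ('l \<Rightarrow> 'l \<Rightarrow> bool) \<Rightarrow> bool" where
  "continuous_dcpo C le \<longleftrightarrow> dcpo_on C le \<and>
     (\<forall>y\<in>C. directed_on C le {x\<in>C. way_below C le x y} \<and> is_lub C le {x\<in>C. way_below C le x y} y)"

definition continuous_lattice :: "'l set \<Rightarrow> ('l \<Rightarrow> 'l \<Rightarrow> bool) \<Rightarrow> bool" where
  "continuous_lattice C le \<longleftrightarrow> complete_lattice_on C le \<and>
     (\<forall>y\<in>C. is_lub C le {x\<in>C. way_below C le x y} y)"

definition scott_topology :: "'l set \<Rightarrow> ('l \<Rightarrow> 'l \<Rightarrow> bool) \<Rightarrow> 'l topology" where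
  "scott_topology C le = topology (\<lambda>U. U \<subseteq> C \<and> (\<forall>x\<in>U. \<forall>y\<in>C. le x y \<longrightarrow> y \<in> U) \<and>
       (\<forall>D s. directed_on C le D \<and> is_lub C le D s \<and> s \<in> U \<longrightarrow> D \<inter> U \<noteq> {}))"

definition irreducible_in :: "'a topology \<Rightarrow> 'a set \<Rightarrow> bool" where
  "irreducible_in X S \<longleftrightarrow> S \<noteq> {} \<and> S \<subseteq> topspace X \<and>
     (\<forall>A B. closedin X A \<and> closedin X B \<and> S \<subseteq> A \<union> B \<longrightarrow> S \<subseteq> A \<or> S \<subseteq> B)"

definition sober_space :: "'a topology \<Rightarrow> bool" where
  "sober_space X \<longleftrightarrow>
     (\<forall>S. closedin X S \<and> irreducible_in X S \<longrightarrow> (\<exists>!x. x \<in> topspace X \<and> X closure_of {x} = S))"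

definition saturated_in :: "'a topology \<Rightarrow> 'a set \<Rightarrow> bool" where
  "saturated_in X K \<longleftrightarrow> K \<subseteq> topspace X \<and> K = topspace X \<inter> \<Inter>{U. openin X U \<and> K \<subseteq> U}"

definition locally_compact_sat :: "'a topology \<Rightarrow> bool" where
  "locally_compact_sat X \<longleftrightarrow>
     (\<forall>x\<in>topspace X. \<forall>U. openin X U \<and> x \<in> U \<longrightarrow>
        (\<exists>V K. openin X V \<and> compactin X K \<and> saturated_in X K \<and> x \<in> V \<and> V \<subseteq> K \<and> K \<subseteq> U))"

definition lc_sober :: "'a topology \<Rightarrow> bool" where
  "lc_sober X \<longleftrightarrow> locally_compact_sat X \<and> sober_space X"

definition opens :: "'a topology \<Rightarrow> 'a set set" where
  "opens X = {U. openin X U}"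

definition frame_hom :: "'l set \<Rightarrow> ('l \<Rightarrow> 'l \<Rightarrow> bool) \<Rightarrow> 'm set \<Rightarrow> ('m \<Rightarrow> 'm \<Rightarrow> bool) \<Rightarrow> ('l \<Rightarrow> 'm) \<Rightarrow> bool" where
  "frame_hom C le C' le' f \<longleftrightarrow> (\<forall>x\<in>C. f x \<in> C') \<and>
     (\<forall>S\<subseteq>C. f (lsup C le S) = lsup C' le' (f ` S)) \<and>
     (\<forall>S\<subseteq>C. finite S \<longrightarrow> f (linf C le S) = linf C' le' (f ` S))"

definition frame_iso :: "'l set \<Rightarrow> ('l \<Rightarrow> 'l \<Rightarrow> bool) \<Rightarrow> 'm set \<Rightarrow> ('m \<Rightarrow> 'm \<Rightarrow> bool) \<Rightarrow> ('l \<Rightarrow> 'm) \<Rightarrow> bool" where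
  "frame_iso C le C' le' f \<longleftrightarrow> frame_hom C le C' le' f \<and> bij_betw f C C'"

definition cp_filters :: "'l set \<Rightarrow> ('l \<Rightarrow> 'l \<Rightarrow> bool) \<Rightarrow> 'l set set" where
  "cp_filters C le = {P. P \<subseteq> C \<and>
       (\<forall>x\<in>P. \<forall>y\<in>C. le x y \<longrightarrow> y \<in> P) \<and>
       (\<forall>V. V \<subseteq> P \<and> finite V \<longrightarrow> linf C le V \<in> P) \<and>
       (\<forall>S\<subseteq>C. lsup C le S \<in> P \<longrightarrow> S \<inter> P \<noteq> {})}"

definition pt_top :: "'l set \<Rightarrow> ('l \<Rightarrow> 'l \<Rightarrow> bool) \<Rightarrow> 'l set topology" where
  "pt_top C le = subtopology (topology_generated_by {{P \<in> cp_filters C le. u \<in> P} | u. u \<in> C}) (cp_filters C le)"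

definition eta :: "'a topology \<Rightarrow> 'a \<Rightarrow> 'a set set" where
  "eta X x = {U. openin X U \<and> x \<in> U}"

definition eps :: "'l set \<Rightarrow> ('l \<Rightarrow> 'l \<Rightarrow> bool) \<Rightarrow> 'l \<Rightarrow> 'l set set" where
  "eps C le u = {P \<in> cp_filters C le. u \<in> P}"

definition cong_preorder :: "'l set \<Rightarrow> ('l \<Rightarrow> 'l \<Rightarrow> bool) \<Rightarrow> ('l \<Rightarrow> 'l \<Rightarrow> bool) \<Rightarrow> bool" where
  "cong_preorder C le R \<longleftrightarrow>
     (\<forall>u v. R u v \<longrightarrow> u \<in> C \<and> v \<in> C) \<and>
     (\<forall>u\<in>C. \<forall>v\<in>C. \<forall>w\<in>C. R u v \<and> R v w \<longrightarrow> R u w) \<and>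
     (\<forall>u\<in>C. \<forall>v\<in>C. le u v \<longrightarrow> R u v) \<and>
     (\<forall>S v. S \<subseteq> C \<and> v \<in> C \<and> (\<forall>u\<in>S. R u v) \<longrightarrow> R (lsup C le S) v) \<and>
     (\<forall>u V. u \<in> C \<and> V \<subseteq> C \<and> finite V \<and> (\<forall>v\<in>V. R u v) \<longrightarrow> R u (linf C le V))"

definition prec_A :: "'l set \<Rightarrow> ('l \<Rightarrow> 'l \<Rightarrow> bool) \<Rightarrow> 'l set \<Rightarrow> 'l \<Rightarrow> 'l \<Rightarrow> bool" where
  "prec_A C le A u v \<longleftrightarrow>
     (\<forall>R. cong_preorder C le R \<and> (\<forall>a\<in>A. R (lsup C le C) a) \<longrightarrow> R u v)"

definition quot_carrier :: "'l set \<Rightarrow> ('l \<Rightarrow> 'l \<Rightarrow> bool) \<Rightarrow> 'l set set" where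
  "quot_carrier C R = {{v \<in> C. R u v \<and> R v u} | u. u \<in> C}"

definition quot_le :: "('l \<Rightarrow> 'l \<Rightarrow> bool) \<Rightarrow> 'l set \<Rightarrow> 'l set \<Rightarrow> bool" where
  "quot_le R P Q \<longleftrightarrow> (\<exists>u\<in>P. \<exists>v\<in>Q. R u v)"

end

theory Submission
  imports Defs
begin

text \<open>
  The heart of the matter is that a quotient of a continuous distributive lattice by countably many
  elements has enough points. If \<open>u\<close> is not below \<open>v\<close> in the quotient, one may replace \<open>v\<close> by the
  largest element equivalent to it and build a chain \<open>u = u\<^sub>0, u\<^sub>1, \<dots>\<close> staying outside the ideal of
  \<open>v\<close> with \<open>u\<^sub>n\<^sub>+\<^sub>1\<close> way below \<open>u\<^sub>n \<and> a\<^sub>n\<close>. The chain generates a Scott-open filter, and an element above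
  \<open>v\<close> that is maximal outside it is prime, hence gives the required point. The points of the quotient
  are the points of the lattice containing every \<open>a\<^sub>n\<close>, a \<open>G\<^sub>\<delta>\<close> set. The same filters, built inside
  an interval \<open>v \<lless> u\<close>, give the compact saturated neighbourhoods of points. In a completely
  distributive lattice, chains descending along the totally-below relation generate points themselves,
  and these make the points a continuous dcpo whose Scott topology is the topology of the spectrum.
\<close>

subsection \<open>Posets and complete lattices\<close>

text \<open>The existence of enough points also serves the side of spaces. If \<open>S\<close> is
  the intersection in \<open>Y\<close> of a countable family \<open>A\<close> of open sets, the open
  sets of \<open>S\<close> are open sets of \<open>Y\<close> compared by their traces on
  \<open>S\<close>, whereas \<open>prec_A\<close> is an intersection of preorders and gives no
  formula for the comparison. Points containing \<open>A\<close> connect the two: for sober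
  \<open>Y\<close> they are the points of \<open>S\<close>, and having enough of them means that
  traces decide \<open>prec_A\<close>. Three details shape the chain. The largest element equivalent
  to \<open>v\<close> is needed because meeting \<open>u_n\<close> with \<open>a_n\<close> could
  drop it into the ideal of \<open>v\<close> itself; the larger ideal is never entered in this way,
  since in the quotient \<open>a_n\<close> is the top. The way-below steps are needed because Zorn's
  lemma asks that suprema of chains outside the filter stay outside. Countability lets a sequence
  pass under each element of \<open>A\<close> at a finite stage, so no limit stage arises at which
  an infimum could fall into the ideal.\<close>

locale poset =
  fixes C :: "'l set" and le :: "'l \<Rightarrow> 'l \<Rightarrow> bool" (infix "\<sqsubseteq>" 50)
  assumes partial_order: "partial_order_on' C le"
begin

lemma refl: "x \<in> C \<Longrightarrow> x \<sqsubseteq> x"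
  and antisym: "x \<sqsubseteq> y \<Longrightarrow> y \<sqsubseteq> x \<Longrightarrow> x \<in> C \<Longrightarrow> y \<in> C \<Longrightarrow> x = y"
  and trans: "x \<sqsubseteq> y \<Longrightarrow> y \<sqsubseteq> z \<Longrightarrow> x \<in> C \<Longrightarrow> y \<in> C \<Longrightarrow> z \<in> C \<Longrightarrow> x \<sqsubseteq> z"
  using partial_order unfolding partial_order_on'_def by blast+

lemma lsup_eq: "is_lub C le S x \<Longrightarrow> lsup C le S = x"
  unfolding lsup_def by (rule the_equality) (auto simp: is_lub_def intro: antisym)

lemma linf_eq: "is_glb C le S x \<Longrightarrow> linf C le S = x"
  unfolding linf_def by (rule the_equality) (auto simp: is_glb_def intro: antisym)

lemma directed_finite_bound:
  assumes "directed_on C le D" "finite V" "\<And>v. v \<in> V \<Longrightarrow> v \<in> C \<and> (\<exists>d\<in>D. v \<sqsubseteq> d)"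
  shows "\<exists>d\<in>D. \<forall>v\<in>V. v \<sqsubseteq> d"
  using assms(2,3)
proof (induction V rule: finite_induct)
  case empty
  then show ?case using assms(1) by (auto simp: directed_on_def)
next
  case (insert x V)
  obtain d e where "d \<in> D" "\<forall>v\<in>V. v \<sqsubseteq> d" "e \<in> D" "x \<sqsubseteq> e"
    using insert by blast
  moreover obtain z where "z \<in> D" "d \<sqsubseteq> z" "e \<sqsubseteq> z"
    using assms(1) \<open>d \<in> D\<close> \<open>e \<in> D\<close> unfolding directed_on_def by blast
  moreover have "D \<subseteq> C" using assms(1) by (auto simp: directed_on_def)
  ultimately show ?case
    using insert.prems by (metis insert_iff subsetD trans)
qed

lemma way_below_imp_le:
  assumes "way_below C le x y" "y \<in> C"
  shows "x \<sqsubseteq> y"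
proof -
  have "directed_on C le {y}" "is_lub C le {y} y" "y \<sqsubseteq> y"
    using assms(2) by (auto simp: directed_on_def is_lub_def refl)
  then show ?thesis using assms(1) unfolding way_below_def by blast
qed

lemma way_below_mono:
  assumes "way_below C le x y" "x' \<sqsubseteq> x" "y \<sqsubseteq> y'" "x' \<in> C" "x \<in> C" "y \<in> C" "y' \<in> C"
  shows "way_below C le x' y'"
  unfolding way_below_def
proof (intro allI impI)
  fix D s assume D: "directed_on C le D \<and> is_lub C le D s \<and> y' \<sqsubseteq> s"
  then have "D \<subseteq> C" "s \<in> C" by (auto simp: directed_on_def is_lub_def)
  moreover have "y \<sqsubseteq> s" using assms D \<open>s \<in> C\<close> trans by blast
  ultimately obtain d where "d \<in> D" "x \<sqsubseteq> d" using assms(1) D unfolding way_below_def by blast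
  with \<open>D \<subseteq> C\<close> show "\<exists>d\<in>D. x' \<sqsubseteq> d" using assms trans by blast
qed

end

locale clat = poset +
  assumes ex_lub: "S \<subseteq> C \<Longrightarrow> \<exists>x. is_lub C le S x"
begin

lemma lsup_lub: "S \<subseteq> C \<Longrightarrow> is_lub C le S (lsup C le S)"
  using ex_lub lsup_eq by metis

lemma linf_glb:
  assumes "S \<subseteq> C"
  shows "is_glb C le S (linf C le S)"
proof -
  obtain x where "is_lub C le {y\<in>C. \<forall>s\<in>S. y \<sqsubseteq> s} x" using ex_lub[of "{y\<in>C. \<forall>s\<in>S. y \<sqsubseteq> s}"] by auto
  then have "is_glb C le S x" using assms unfolding is_lub_def is_glb_def by blast
  then show ?thesis using linf_eq by metis
qed

lemma lsup_closed: "S \<subseteq> C \<Longrightarrow> lsup C le S \<in> C"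
  and lsup_upper: "S \<subseteq> C \<Longrightarrow> s \<in> S \<Longrightarrow> s \<sqsubseteq> lsup C le S"
  and lsup_least: "S \<subseteq> C \<Longrightarrow> y \<in> C \<Longrightarrow> (\<And>s. s \<in> S \<Longrightarrow> s \<sqsubseteq> y) \<Longrightarrow> lsup C le S \<sqsubseteq> y"
  using lsup_lub[of S] unfolding is_lub_def by auto

lemma linf_closed: "S \<subseteq> C \<Longrightarrow> linf C le S \<in> C"
  and linf_lower: "S \<subseteq> C \<Longrightarrow> s \<in> S \<Longrightarrow> linf C le S \<sqsubseteq> s"
  and linf_greatest: "S \<subseteq> C \<Longrightarrow> y \<in> C \<Longrightarrow> (\<And>s. s \<in> S \<Longrightarrow> y \<sqsubseteq> s) \<Longrightarrow> y \<sqsubseteq> linf C le S"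
  using linf_glb[of S] unfolding is_glb_def by auto

lemma lsup_carrier: "lsup C le C \<in> C" "x \<in> C \<Longrightarrow> x \<sqsubseteq> lsup C le C"
  using lsup_closed lsup_upper by auto

lemma lsup_le_iff: "S \<subseteq> C \<Longrightarrow> y \<in> C \<Longrightarrow> lsup C le S \<sqsubseteq> y \<longleftrightarrow> (\<forall>s\<in>S. s \<sqsubseteq> y)"
  by (meson lsup_closed lsup_least lsup_upper subsetD trans)

lemma lsup_mono: "S \<subseteq> T \<Longrightarrow> T \<subseteq> C \<Longrightarrow> lsup C le S \<sqsubseteq> lsup C le T"
  by (rule lsup_least) (auto intro: lsup_upper lsup_closed)

text \<open>Turns an arbitrary join into a directed one, to which Scott-openness applies; the finite
  subcovers in the compactness proof come from here. The case \<open>V = {}\<close> keeps the family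
  nonempty.\<close>

lemma directed_finite_lsups:
  assumes "W \<subseteq> C"
  shows "directed_on C le (lsup C le ` {V. V \<subseteq> W \<and> finite V})"
    and "is_lub C le (lsup C le ` {V. V \<subseteq> W \<and> finite V}) (lsup C le W)"
proof -
  have sub: "V \<subseteq> C" if "V \<subseteq> W" for V using that assms by blast
  show "directed_on C le (lsup C le ` {V. V \<subseteq> W \<and> finite V})"
    unfolding directed_on_def
  proof (intro conjI ballI)
    fix x y assume "x \<in> lsup C le ` {V. V \<subseteq> W \<and> finite V}" "y \<in> lsup C le ` {V. V \<subseteq> W \<and> finite V}"
    then obtain V V' where V: "x = lsup C le V" "V \<subseteq> W" "finite V"
      "y = lsup C le V'" "V' \<subseteq> W" "finite V'" by auto
    have "x \<sqsubseteq> lsup C le (V \<union> V')" "y \<sqsubseteq> lsup C le (V \<union> V')"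
      using V sub by (auto intro!: lsup_mono)
    then show "\<exists>z\<in>lsup C le ` {V. V \<subseteq> W \<and> finite V}. x \<sqsubseteq> z \<and> y \<sqsubseteq> z"
      using V by blast
  qed (use sub lsup_closed in auto)
  show "is_lub C le (lsup C le ` {V. V \<subseteq> W \<and> finite V}) (lsup C le W)"
    unfolding is_lub_def
  proof (intro conjI ballI impI)
    fix y assume y: "y \<in> C" "\<forall>s\<in>lsup C le ` {V. V \<subseteq> W \<and> finite V}. s \<sqsubseteq> y"
    have "w \<sqsubseteq> y" if "w \<in> W" for w
    proof -
      have "lsup C le {w} \<sqsubseteq> y" using y(2) that by auto
      then show ?thesis using lsup_le_iff[of "{w}" y] y(1) that assms by auto
    qed
    then show "lsup C le W \<sqsubseteq> y" using y assms lsup_least by blast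
  next
    fix s assume "s \<in> lsup C le ` {V. V \<subseteq> W \<and> finite V}"
    then show "s \<sqsubseteq> lsup C le W"
      using assms lsup_mono by blast
  qed (use assms lsup_closed in auto)
qed

end

lemma clat_iff: "clat C le \<longleftrightarrow> complete_lattice_on C le"
  unfolding clat_def clat_axioms_def poset_def complete_lattice_on_def by blast

text \<open>An order isomorphism transports every lub and glb of the source, and antisymmetry makes
  those of the target unique. This is why the target is assumed to be only a poset.\<close>

lemma frame_isoI:
  assumes "clat C le" "poset C' le'" "bij_betw f C C'"
    and iff: "\<And>x y. x \<in> C \<Longrightarrow> y \<in> C \<Longrightarrow> le' (f x) (f y) \<longleftrightarrow> le x y"
  shows "frame_iso C le C' le' f"
proof -
  interpret clat C le by fact
  interpret C': poset C' le' by fact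
  have im: "C' = f ` C" using assms(3) by (simp add: bij_betw_def)
  have "is_lub C' le' (f ` S) (f (lsup C le S))" if "S \<subseteq> C" for S
    using lsup_lub[OF that] that unfolding is_lub_def im by (simp add: iff subset_iff)
  moreover have "is_glb C' le' (f ` S) (f (linf C le S))" if "S \<subseteq> C" for S
    using linf_glb[OF that] that unfolding is_glb_def im by (simp add: iff subset_iff)
  ultimately show ?thesis
    unfolding frame_iso_def frame_hom_def using assms(3) C'.lsup_eq C'.linf_eq im by (simp (no_asm_simp)) (metis imageI)
qed

subsection \<open>Completely prime filters\<close>

context clat
begin

text \<open>Nonemptiness and lower bounds of pairs give by induction a lower bound in
  \<open>P\<close> of every finite \<open>V\<close>, and \<open>linf C le V\<close> lies above it.
  The case \<open>S = {}\<close> of \<open>prime\<close> keeps the bottom out.\<close>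

lemma cp_filtersI:
  assumes "P \<subseteq> C" "P \<noteq> {}"
    and up: "\<And>x y. x \<in> P \<Longrightarrow> y \<in> C \<Longrightarrow> x \<sqsubseteq> y \<Longrightarrow> y \<in> P"
    and filt: "\<And>x y. x \<in> P \<Longrightarrow> y \<in> P \<Longrightarrow> \<exists>z\<in>P. z \<sqsubseteq> x \<and> z \<sqsubseteq> y"
    and prime: "\<And>S. S \<subseteq> C \<Longrightarrow> lsup C le S \<in> P \<Longrightarrow> \<exists>s\<in>S. s \<in> P"
  shows "P \<in> cp_filters C le"
proof -
  have "linf C le V \<in> P" if "finite V" "V \<subseteq> P" for V
  proof -
    have "\<exists>z\<in>P. \<forall>v\<in>V. z \<sqsubseteq> v"
      using that
    proof (induction V rule: finite_induct)
      case empty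
      then show ?case using assms(2) by auto
    next
      case (insert x V)
      then obtain z where z: "z \<in> P" "\<forall>v\<in>V. z \<sqsubseteq> v" by auto
      obtain z' where "z' \<in> P" "z' \<sqsubseteq> x" "z' \<sqsubseteq> z" using filt[of x z] insert.prems z by auto
      then show ?case using z insert.prems assms(1) by (metis insert_iff subset_iff trans)
    qed
    then obtain z where z: "z \<in> P" "\<forall>v\<in>V. z \<sqsubseteq> v" by blast
    have "V \<subseteq> C" "z \<in> C" using that z assms(1) by auto
    with z show ?thesis by (auto intro: up linf_closed linf_greatest)
  qed
  then show ?thesis
    unfolding cp_filters_def mem_Collect_eq
    using assms(1) by (intro conjI ballI allI impI) (auto intro: up dest: prime)
qed

lemma cp_filtersD:
  assumes "P \<in> cp_filters C le"
  shows "P \<subseteq> C"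
    and "\<And>x y. x \<in> P \<Longrightarrow> y \<in> C \<Longrightarrow> x \<sqsubseteq> y \<Longrightarrow> y \<in> P"
    and "\<And>V. V \<subseteq> P \<Longrightarrow> finite V \<Longrightarrow> linf C le V \<in> P"
    and "\<And>S. S \<subseteq> C \<Longrightarrow> lsup C le S \<in> P \<Longrightarrow> \<exists>s\<in>S. s \<in> P"
proof -
  have P: "P \<subseteq> C" "\<forall>x\<in>P. \<forall>y\<in>C. x \<sqsubseteq> y \<longrightarrow> y \<in> P" "\<forall>V. V \<subseteq> P \<and> finite V \<longrightarrow> linf C le V \<in> P"
    "\<forall>S\<subseteq>C. lsup C le S \<in> P \<longrightarrow> S \<inter> P \<noteq> {}"
    using assms by (simp_all add: cp_filters_def)
  show "P \<subseteq> C" by (rule P)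
  show "y \<in> P" if "x \<in> P" "y \<in> C" "x \<sqsubseteq> y" for x y using P(2) that by simp
  show "linf C le V \<in> P" if "V \<subseteq> P" "finite V" for V using P(3) that by simp
  show "\<exists>s\<in>S. s \<in> P" if "S \<subseteq> C" "lsup C le S \<in> P" for S using P(4) that by (metis disjoint_iff)
qed

lemma lsup_carrier_in_cp_filter: "P \<in> cp_filters C le \<Longrightarrow> lsup C le C \<in> P"
  by (rule cp_filtersD(2)[OF _ cp_filtersD(3)[of P "{}"]]) (use linf_closed lsup_carrier in auto)

lemma eps_subset: "eps C le u \<subseteq> cp_filters C le"
  by (auto simp: eps_def)

lemma eps_mono: "u \<sqsubseteq> v \<Longrightarrow> v \<in> C \<Longrightarrow> eps C le u \<subseteq> eps C le v"
  unfolding eps_def using cp_filtersD(2) by blast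

lemma eps_lsup: "S \<subseteq> C \<Longrightarrow> eps C le (lsup C le S) = \<Union>(eps C le ` S)"
proof (intro equalityI subsetI)
  fix P assume "S \<subseteq> C" "P \<in> eps C le (lsup C le S)"
  then show "P \<in> \<Union>(eps C le ` S)" using cp_filtersD(4)[of P S] by (auto simp: eps_def)
next
  fix P assume *: "S \<subseteq> C" "P \<in> \<Union>(eps C le ` S)"
  then obtain s where "s \<in> S" "P \<in> eps C le s" by blast
  with * show "P \<in> eps C le (lsup C le S)"
    using eps_mono[OF lsup_upper lsup_closed] by blast
qed

lemma eps_linf: "V \<subseteq> C \<Longrightarrow> finite V \<Longrightarrow> eps C le (linf C le V) = cp_filters C le \<inter> \<Inter>(eps C le ` V)"
proof (intro equalityI subsetI)
  fix P assume *: "V \<subseteq> C" "finite V" "P \<in> cp_filters C le \<inter> \<Inter>(eps C le ` V)"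
  then have "V \<subseteq> P" by (auto simp: eps_def)
  then show "P \<in> eps C le (linf C le V)" using * cp_filtersD(3) by (auto simp: eps_def)
next
  fix P assume *: "V \<subseteq> C" "finite V" "P \<in> eps C le (linf C le V)"
  then have "P \<in> eps C le v" if "v \<in> V" for v
    using eps_mono[OF linf_lower[OF _ that]] that by blast
  then show "P \<in> cp_filters C le \<inter> \<Inter>(eps C le ` V)"
    using * eps_subset by blast
qed

lemma eps_lsup_carrier: "eps C le (lsup C le C) = cp_filters C le"
  using lsup_carrier_in_cp_filter by (auto simp: eps_def)

text \<open>\<open>eps\<close> turns joins into unions and finite meets into intersections, so the
  generating sets are already closed under everything that generates a topology.\<close>

lemma openin_pt_top: "openin (pt_top C le) U \<longleftrightarrow> (\<exists>u\<in>C. U = eps C le u)"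
proof -
  let ?B = "{{P \<in> cp_filters C le. u \<in> P} |u. u \<in> C}"
  have "\<exists>u\<in>C. U = eps C le u" if "generate_topology_on ?B U" for U
    using that
  proof (induction rule: generate_topology_on.induct)
    case Empty
    have "eps C le (lsup C le {}) = {}" using eps_lsup[of "{}"] by simp
    then show ?case using lsup_closed[of "{}"] by (metis empty_subsetI)
  next
    case (Int a b)
    then obtain u v where uv: "u \<in> C" "v \<in> C" "a = eps C le u" "b = eps C le v" by auto
    then have "eps C le (linf C le {u, v}) = a \<inter> b"
      using eps_linf[of "{u,v}"] eps_subset by auto
    then show ?case using uv linf_closed[of "{u,v}"] by auto
  next
    case (UN K)
    then have "\<Union>K = eps C le (lsup C le {u\<in>C. eps C le u \<in> K})"
      using eps_lsup[of "{u\<in>C. eps C le u \<in> K}"] by blast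
    then show ?case using lsup_closed[of "{u\<in>C. eps C le u \<in> K}"] by blast
  next
    case (Basis s)
    then show ?case by (auto simp: eps_def)
  qed
  moreover have "generate_topology_on ?B (eps C le u)" if "u \<in> C" for u
    using that by (intro generate_topology_on.Basis) (auto simp: eps_def)
  ultimately have "generate_topology_on ?B U \<longleftrightarrow> (\<exists>u\<in>C. U = eps C le u)" for U
    by blast
  then have gen: "openin (topology_generated_by ?B) = (\<lambda>U. \<exists>u\<in>C. U = eps C le u)"
    by (simp add: openin_topology_generated_by_iff fun_eq_iff)
  have "eps C le u \<inter> cp_filters C le = eps C le u" for u
    using eps_subset by blast
  then show ?thesis
    unfolding pt_top_def openin_subtopology gen by metis
qed

lemma topspace_pt_top: "topspace (pt_top C le) = cp_filters C le"
proof
  show "topspace (pt_top C le) \<subseteq> cp_filters C le"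
    unfolding topspace_def openin_pt_top using eps_subset by blast
  show "cp_filters C le \<subseteq> topspace (pt_top C le)"
    using openin_subset[of "pt_top C le" "cp_filters C le"] openin_pt_top eps_lsup_carrier lsup_carrier
    by metis
qed

lemma closedin_pt_top: "closedin (pt_top C le) T \<longleftrightarrow> (\<exists>u\<in>C. T = cp_filters C le - eps C le u)"
  unfolding closedin_def topspace_pt_top openin_pt_top using eps_subset by blast

text \<open>Every open set is some \<open>eps u\<close> and \<open>eps\<close> is monotone, so the
  counit can only fail by not reflecting the order. Separation by points excludes that.\<close>

lemma eps_frame_iso:
  assumes "\<And>u v. u \<in> C \<Longrightarrow> v \<in> C \<Longrightarrow> \<not> u \<sqsubseteq> v \<Longrightarrow> \<exists>P\<in>cp_filters C le. u \<in> P \<and> v \<notin> P"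
  shows "frame_iso C le (opens (pt_top C le)) (\<subseteq>) (eps C le)"
proof (rule frame_isoI)
  show iff: "eps C le x \<subseteq> eps C le y \<longleftrightarrow> x \<sqsubseteq> y" if "x \<in> C" "y \<in> C" for x y
    using assms[OF that] eps_mono that by (auto simp: eps_def)
  show "bij_betw (eps C le) C (opens (pt_top C le))"
    unfolding bij_betw_def inj_on_def
  proof (intro conjI ballI impI)
    show "x = y" if "x \<in> C" "y \<in> C" "eps C le x = eps C le y" for x y
      using iff[of x y] iff[of y x] antisym that by simp
  qed (auto simp: opens_def openin_pt_top)
qed (unfold_locales, auto simp: partial_order_on'_def)

end

subsection \<open>Quotient frames\<close>

locale quotient = clat +
  fixes R :: "'a \<Rightarrow> 'a \<Rightarrow> bool"
  assumes cong: "cong_preorder C le R"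
begin

lemma R_carrier: "R u v \<Longrightarrow> u \<in> C \<and> v \<in> C"
  and R_trans: "R u v \<Longrightarrow> R v w \<Longrightarrow> R u w"
  and R_le: "u \<in> C \<Longrightarrow> v \<in> C \<Longrightarrow> u \<sqsubseteq> v \<Longrightarrow> R u v"
  and R_lsup: "S \<subseteq> C \<Longrightarrow> v \<in> C \<Longrightarrow> (\<And>u. u \<in> S \<Longrightarrow> R u v) \<Longrightarrow> R (lsup C le S) v"
  and R_linf: "V \<subseteq> C \<Longrightarrow> u \<in> C \<Longrightarrow> finite V \<Longrightarrow> (\<And>v. v \<in> V \<Longrightarrow> R u v) \<Longrightarrow> R u (linf C le V)"
proof -
  note R = cong[unfolded cong_preorder_def, THEN conjunct1]
    cong[unfolded cong_preorder_def, THEN conjunct2, THEN conjunct1]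
    cong[unfolded cong_preorder_def, THEN conjunct2, THEN conjunct2, THEN conjunct1]
    cong[unfolded cong_preorder_def, THEN conjunct2, THEN conjunct2, THEN conjunct2, THEN conjunct1]
    cong[unfolded cong_preorder_def, THEN conjunct2, THEN conjunct2, THEN conjunct2, THEN conjunct2]
  show "R u v \<Longrightarrow> u \<in> C \<and> v \<in> C" using R(1) by simp
  show "R u v \<Longrightarrow> R v w \<Longrightarrow> R u w" using R(1,2) by metis
  show "u \<in> C \<Longrightarrow> v \<in> C \<Longrightarrow> u \<sqsubseteq> v \<Longrightarrow> R u v" using R(3) by simp
  show "S \<subseteq> C \<Longrightarrow> v \<in> C \<Longrightarrow> (\<And>u. u \<in> S \<Longrightarrow> R u v) \<Longrightarrow> R (lsup C le S) v" using R(4) by simp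
  show "V \<subseteq> C \<Longrightarrow> u \<in> C \<Longrightarrow> finite V \<Longrightarrow> (\<And>v. v \<in> V \<Longrightarrow> R u v) \<Longrightarrow> R u (linf C le V)" using R(5) by simp
qed

lemma R_refl: "u \<in> C \<Longrightarrow> R u u"
  by (rule R_le) (auto intro: refl)

definition cls :: "'a \<Rightarrow> 'a set" where
  "cls u = {v \<in> C. R u v \<and> R v u}"

abbreviation Q where "Q \<equiv> quot_carrier C R"
abbreviation le_Q where "le_Q \<equiv> quot_le R"

lemma quot_carrier_eq: "Q = cls ` C"
  unfolding quot_carrier_def cls_def by blast

lemma quot_le_cls: "u \<in> C \<Longrightarrow> v \<in> C \<Longrightarrow> le_Q (cls u) (cls v) \<longleftrightarrow> R u v"
  unfolding quot_le_def cls_def using R_refl R_trans by blast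

lemma cls_eq_iff: "u \<in> C \<Longrightarrow> v \<in> C \<Longrightarrow> cls u = cls v \<longleftrightarrow> R u v \<and> R v u"
  unfolding cls_def using R_refl R_trans by blast

lemma poset_quot: "poset Q le_Q"
proof
  have tr: "le_Q x z" if xyz: "x \<in> Q" "y \<in> Q" "z \<in> Q" "le_Q x y" "le_Q y z" for x y z
  proof -
    obtain u v w where "x = cls u" "y = cls v" "z = cls w" "u \<in> C" "v \<in> C" "w \<in> C"
      using xyz(1-3) unfolding quot_carrier_eq by auto
    then show ?thesis using xyz(4,5) quot_le_cls R_trans by metis
  qed
  show "partial_order_on' Q le_Q"
    unfolding partial_order_on'_def
  proof (intro conjI ballI impI)
    show "le_Q x x" if "x \<in> Q" for x
      using that R_refl quot_le_cls unfolding quot_carrier_eq by auto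
    show "x = y" if "x \<in> Q" "y \<in> Q" "le_Q x y \<and> le_Q y x" for x y
    proof -
      obtain u v where "u \<in> C" "x = cls u" "v \<in> C" "y = cls v"
        using \<open>x \<in> Q\<close> \<open>y \<in> Q\<close> unfolding quot_carrier_eq by auto
      then show ?thesis using that(3) by (simp add: quot_le_cls cls_eq_iff)
    qed
  qed (use tr in blast)
qed

lemma is_lub_quot:
  assumes "S \<subseteq> C"
  shows "is_lub Q le_Q (cls ` S) (cls (lsup C le S))"
  unfolding is_lub_def
proof (intro conjI ballI impI)
  show "cls (lsup C le S) \<in> Q" using assms lsup_closed by (auto simp: quot_carrier_eq)
next
  fix s assume "s \<in> cls ` S"
  then obtain v where v: "v \<in> S" "s = cls v" by auto
  then show "le_Q s (cls (lsup C le S))"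
    using assms quot_le_cls[of v "lsup C le S"] R_le lsup_upper lsup_closed by blast
next
  fix y assume y: "y \<in> Q" "\<forall>s\<in>cls ` S. le_Q s y"
  then obtain w where w: "w \<in> C" "y = cls w" by (auto simp: quot_carrier_eq)
  have "R v w" if "v \<in> S" for v
    using y w assms that quot_le_cls[of v w] by auto
  then show "le_Q (cls (lsup C le S)) y"
    using w assms R_lsup quot_le_cls lsup_closed by simp
qed

text \<open>A congruence preorder respects arbitrary joins but only finite meets, hence the
  finiteness here in contrast to \<open>is_lub_quot\<close>.\<close>

lemma is_glb_quot:
  assumes "S \<subseteq> C" "finite S"
  shows "is_glb Q le_Q (cls ` S) (cls (linf C le S))"
  unfolding is_glb_def
proof (intro conjI ballI impI)
  show "cls (linf C le S) \<in> Q" using assms linf_closed by (auto simp: quot_carrier_eq)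
next
  fix s assume "s \<in> cls ` S"
  then obtain v where v: "v \<in> S" "s = cls v" by auto
  then show "le_Q (cls (linf C le S)) s"
    using assms quot_le_cls[of "linf C le S" v] R_le linf_lower linf_closed by blast
next
  fix y assume y: "y \<in> Q" "\<forall>s\<in>cls ` S. le_Q y s"
  then obtain w where w: "w \<in> C" "y = cls w" by (auto simp: quot_carrier_eq)
  have "R w v" if "v \<in> S" for v
    using y w assms that quot_le_cls[of w v] by auto
  then show "le_Q y (cls (linf C le S))"
    using w assms R_linf quot_le_cls linf_closed by simp
qed

lemma subset_quot_carrierE:
  assumes "S \<subseteq> Q"
  obtains T where "T \<subseteq> C" "S = cls ` T"
  using assms unfolding quot_carrier_eq by (meson subset_imageE)

lemma clat_quot: "clat Q le_Q"
proof -
  have "\<exists>x. is_lub Q le_Q S x" if "S \<subseteq> Q" for S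
    using that is_lub_quot by (metis subset_quot_carrierE)
  then show ?thesis using poset_quot by (simp add: clat_def clat_axioms_def)
qed

sublocale quot: clat Q le_Q
  by (rule clat_quot)

lemma lsup_quot: "S \<subseteq> C \<Longrightarrow> lsup Q le_Q (cls ` S) = cls (lsup C le S)"
  using is_lub_quot quot.lsup_eq by blast

lemma linf_quot: "S \<subseteq> C \<Longrightarrow> finite S \<Longrightarrow> linf Q le_Q (cls ` S) = cls (linf C le S)"
  using is_glb_quot quot.linf_eq by blast

text \<open>The map on points induced by the quotient map \<open>cls\<close>: inverse image.\<close>

definition pull :: "'a set set \<Rightarrow> 'a set" where
  "pull P = {x \<in> C. cls x \<in> P}"

text \<open>With points viewed as frame homomorphisms into the two-element frame, these are the
  points that factor through the quotient.\<close>

definition R_closed_pts :: "'a set set" where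
  "R_closed_pts = {P \<in> cp_filters C le. \<forall>x y. R x y \<longrightarrow> x \<in> P \<longrightarrow> y \<in> P}"

lemma pull_in:
  assumes "P \<in> cp_filters Q le_Q"
  shows "pull P \<in> R_closed_pts"
proof -
  note P = quot.cp_filtersD[OF assms]
  have closed: "y \<in> pull P" if "R x y" "x \<in> pull P" for x y
    using that R_carrier[OF that(1)] P(2)[of "cls x" "cls y"] quot_le_cls[of x y]
    by (auto simp: pull_def quot_carrier_eq)
  have "pull P \<in> cp_filters C le"
  proof (rule cp_filtersI)
    show "pull P \<subseteq> C" by (auto simp: pull_def)
    have "linf Q le_Q {} \<in> P" using P(3)[of "{}"] by simp
    then obtain x where "x \<in> C" "cls x \<in> P"
      using P(1) unfolding quot_carrier_eq by (metis imageE in_mono)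
    then show "pull P \<noteq> {}" by (auto simp: pull_def)
    show "y \<in> pull P" if "x \<in> pull P" "y \<in> C" "x \<sqsubseteq> y" for x y
      using closed[of x y] R_le[of x y] that by (auto simp: pull_def)
    show "\<exists>z\<in>pull P. z \<sqsubseteq> x \<and> z \<sqsubseteq> y" if "x \<in> pull P" "y \<in> pull P" for x y
    proof
      have xy: "{x, y} \<subseteq> C" "cls ` {x, y} \<subseteq> P" using that by (auto simp: pull_def)
      then have "cls (linf C le {x, y}) \<in> P"
        using P(3)[of "cls ` {x, y}"] linf_quot[of "{x,y}"] by simp
      then show "linf C le {x, y} \<in> pull P"
        using xy(1) linf_closed by (simp add: pull_def)
      show "linf C le {x, y} \<sqsubseteq> x \<and> linf C le {x, y} \<sqsubseteq> y"
        using linf_lower[OF xy(1)] by simp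
    qed
    show "\<exists>s\<in>S. s \<in> pull P" if "S \<subseteq> C" "lsup C le S \<in> pull P" for S
      using P(4)[of "cls ` S"] that lsup_quot[of S] by (auto simp: pull_def quot_carrier_eq)
  qed
  then show ?thesis unfolding R_closed_pts_def using closed by blast
qed

text \<open>Closure under \<open>R\<close> makes \<open>P\<close> a union of classes, so
  \<open>cls x\<close> is in the image only if \<open>x\<close> is in \<open>P\<close> (this is
  \<open>mem\<close>). Hence taking images under \<open>cls\<close> inverts
  \<open>pull\<close>.\<close>

lemma cls_image_in:
  assumes "P \<in> R_closed_pts"
  shows "cls ` P \<in> cp_filters Q le_Q" "pull (cls ` P) = P"
proof -
  have PC: "P \<in> cp_filters C le" and closed: "\<And>x y. R x y \<Longrightarrow> x \<in> P \<Longrightarrow> y \<in> P"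
    using assms by (auto simp: R_closed_pts_def)
  note P = cp_filtersD[OF PC]
  have mem: "cls x \<in> cls ` P \<longleftrightarrow> x \<in> P" if "x \<in> C" for x
  proof
    assume "cls x \<in> cls ` P"
    then obtain y where "y \<in> P" "cls x = cls y" by auto
    then show "x \<in> P" using cls_eq_iff[of x y] closed[of y x] P(1) that by auto
  qed simp
  show "pull (cls ` P) = P"
    using mem P(1) by (auto simp: pull_def)
  show "cls ` P \<in> cp_filters Q le_Q"
  proof (rule quot.cp_filtersI)
    show "cls ` P \<subseteq> Q" using P(1) by (auto simp: quot_carrier_eq)
    show "cls ` P \<noteq> {}" using lsup_carrier_in_cp_filter[OF PC] by auto
    show "y \<in> cls ` P" if "x \<in> cls ` P" "y \<in> Q" "le_Q x y" for x y
    proof -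
      obtain u v where "u \<in> P" "x = cls u" "v \<in> C" "y = cls v"
        using \<open>x \<in> cls ` P\<close> \<open>y \<in> Q\<close> unfolding quot_carrier_eq by auto
      then show ?thesis using that(3) quot_le_cls[of u v] closed[of u v] P(1) by auto
    qed
    show "\<exists>z\<in>cls ` P. le_Q z x \<and> le_Q z y" if xy: "x \<in> cls ` P" "y \<in> cls ` P" for x y
    proof -
      obtain u v where uv: "u \<in> P" "x = cls u" "v \<in> P" "y = cls v" using xy by auto
      then have "{u, v} \<subseteq> C" using P(1) by auto
      then have "le_Q (cls (linf C le {u, v})) x" "le_Q (cls (linf C le {u, v})) y"
        using uv is_glb_quot[of "{u, v}"] by (auto simp: is_glb_def)
      then show ?thesis using P(3)[of "{u, v}"] uv by auto
    qed
    show "\<exists>s\<in>S. s \<in> cls ` P" if S: "S \<subseteq> Q" "lsup Q le_Q S \<in> cls ` P" for S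
    proof -
      obtain T where T: "T \<subseteq> C" "S = cls ` T" using S(1) subset_quot_carrierE by blast
      then have "lsup C le T \<in> P" using S(2) lsup_quot[of T] mem lsup_closed by simp
      then show ?thesis using P(4)[of T] T by auto
    qed
  qed
qed

lemma bij_betw_pull: "bij_betw pull (cp_filters Q le_Q) R_closed_pts"
proof (rule bij_betwI[where g = "image cls"])
  show "cls ` pull P = P" if "P \<in> cp_filters Q le_Q" for P
    using quot.cp_filtersD(1)[OF that] by (auto simp: pull_def quot_carrier_eq)
qed (use pull_in cls_image_in in auto)

text \<open>The inverse image of \<open>eps C le u\<close> under \<open>pull\<close> is
  \<open>eps\<close> of \<open>cls u\<close>, and every element of the quotient is some
  \<open>cls u\<close>, so the bijection matches the open sets exactly.\<close>

lemma homeomorphic_map_pull: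
  "homeomorphic_map (pt_top Q le_Q) (subtopology (pt_top C le) R_closed_pts) pull"
proof -
  have T: "R_closed_pts \<subseteq> cp_filters C le" by (auto simp: R_closed_pts_def)
  have pre: "{P \<in> cp_filters Q le_Q. pull P \<in> eps C le u \<inter> R_closed_pts} = eps Q le_Q (cls u)" if "u \<in> C" for u
    using pull_in T that by (auto simp: eps_def pull_def)
  have "openin (pt_top Q le_Q) {P \<in> cp_filters Q le_Q. pull P \<in> U} \<longleftrightarrow>
        (\<exists>u\<in>C. U = eps C le u \<inter> R_closed_pts)" (is "?L \<longleftrightarrow> ?R") if U: "U \<subseteq> R_closed_pts" for U
  proof
    assume ?L
    then obtain w where "w \<in> Q" "{P \<in> cp_filters Q le_Q. pull P \<in> U} = eps Q le_Q w"
      unfolding quot.openin_pt_top by blast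
    moreover obtain u where "u \<in> C" "w = cls u"
      using \<open>w \<in> Q\<close> unfolding quot_carrier_eq by auto
    ultimately have u: "u \<in> C" "{P \<in> cp_filters Q le_Q. pull P \<in> U} = eps Q le_Q (cls u)"
      by simp_all
    have "P \<in> U \<longleftrightarrow> P \<in> eps C le u" if P: "P \<in> R_closed_pts" for P
    proof -
      have "P \<in> U \<longleftrightarrow> cls ` P \<in> {P \<in> cp_filters Q le_Q. pull P \<in> U}"
        using cls_image_in[OF P] by simp
      also have "\<dots> \<longleftrightarrow> cls ` P \<in> {P \<in> cp_filters Q le_Q. pull P \<in> eps C le u \<inter> R_closed_pts}"
        unfolding u(2) pre[OF u(1)] ..
      finally show ?thesis using cls_image_in[OF P] P by simp
    qed
    then show ?R using u(1) U by blast
  next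
    assume ?R
    then obtain u where "u \<in> C" "U = eps C le u \<inter> R_closed_pts" by blast
    moreover from this have "cls u \<in> Q" unfolding quot_carrier_eq by blast
    ultimately show ?L unfolding quot.openin_pt_top using pre by blast
  qed
  then show ?thesis
    using bij_betw_pull T
    unfolding homeomorphic_map_def quotient_map_def bij_betw_def openin_subtopology
      topspace_subtopology openin_pt_top topspace_pt_top quot.topspace_pt_top
    by (simp add: inf.absorb2) (metis (no_types, lifting))
qed

end

section \<open>The least congruence preorder that puts the top below \<open>A\<close>\<close>

context clat
begin

lemma cong_preorderI:
  assumes "\<And>u v. R u v \<Longrightarrow> u \<in> C \<and> v \<in> C"
    and "\<And>u v w. R u v \<Longrightarrow> R v w \<Longrightarrow> R u w"
    and "\<And>u v. u \<in> C \<Longrightarrow> v \<in> C \<Longrightarrow> u \<sqsubseteq> v \<Longrightarrow> R u v"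
    and "\<And>S v. S \<subseteq> C \<Longrightarrow> v \<in> C \<Longrightarrow> (\<And>u. u \<in> S \<Longrightarrow> R u v) \<Longrightarrow> R (lsup C le S) v"
    and "\<And>u V. u \<in> C \<Longrightarrow> V \<subseteq> C \<Longrightarrow> finite V \<Longrightarrow> (\<And>v. v \<in> V \<Longrightarrow> R u v) \<Longrightarrow> R u (linf C le V)"
  shows "cong_preorder C le R"
  unfolding cong_preorder_def
proof (intro conjI)
  show "\<forall>u v. R u v \<longrightarrow> u \<in> C \<and> v \<in> C"
    by (intro allI impI) (rule assms(1))
  show "\<forall>u\<in>C. \<forall>v\<in>C. \<forall>w\<in>C. R u v \<and> R v w \<longrightarrow> R u w"
    by (intro ballI impI, elim conjE) (rule assms(2))
  show "\<forall>u\<in>C. \<forall>v\<in>C. u \<sqsubseteq> v \<longrightarrow> R u v"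
    by (intro ballI impI) (rule assms(3))
  show "\<forall>S v. S \<subseteq> C \<and> v \<in> C \<and> (\<forall>u\<in>S. R u v) \<longrightarrow> R (lsup C le S) v"
    by (intro allI impI, elim conjE) (rule assms(4), auto)
  show "\<forall>u V. u \<in> C \<and> V \<subseteq> C \<and> finite V \<and> (\<forall>v\<in>V. R u v) \<longrightarrow> R u (linf C le V)"
    by (intro allI impI, elim conjE) (rule assms(5), auto)
qed

lemma cong_preorder_prec_A:
  assumes "A \<subseteq> C"
  shows "cong_preorder C le (prec_A C le A)"
proof -
  let ?P = "\<lambda>R. cong_preorder C le R \<and> (\<forall>a\<in>A. R (lsup C le C) a)"
  have q: "quotient C le R" if "?P R" for R
    using that by (simp add: quotient_def quotient_axioms_def clat_axioms)
  have I: "prec_A C le A u v" if "\<And>R. ?P R \<Longrightarrow> R u v" for u v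
    unfolding prec_A_def by (intro allI impI) (rule that)
  have D: "R u v" if "prec_A C le A u v" "?P R" for R u v
    by (rule that(1)[unfolded prec_A_def, rule_format, OF that(2)])
  show ?thesis
  proof (rule cong_preorderI)
    \<comment> \<open>The total relation on \<open>C\<close> is a member of the family being
      intersected; it confines \<open>prec_A\<close> to the carrier.\<close>
    have "cong_preorder C le (\<lambda>u v. u \<in> C \<and> v \<in> C)"
      by (rule cong_preorderI) (auto intro: lsup_closed linf_closed)
    then have "?P (\<lambda>u v. u \<in> C \<and> v \<in> C)" using assms lsup_carrier by auto
    then show "u \<in> C \<and> v \<in> C" if "prec_A C le A u v" for u v
      using D[OF that] by blast
    show "prec_A C le A u w" if "prec_A C le A u v" "prec_A C le A v w" for u v w
      by (rule I) (rule quotient.R_trans[OF q D[OF that(1)] D[OF that(2)]])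
    show "prec_A C le A u v" if "u \<in> C" "v \<in> C" "u \<sqsubseteq> v" for u v
      by (rule I) (rule quotient.R_le[OF q that])
    show "prec_A C le A (lsup C le S) v" if "S \<subseteq> C" "v \<in> C" "\<And>u. u \<in> S \<Longrightarrow> prec_A C le A u v" for S v
      by (rule I) (rule quotient.R_lsup[OF q that(1,2) D[OF that(3)]])
    show "prec_A C le A u (linf C le V)"
      if "u \<in> C" "V \<subseteq> C" "finite V" "\<And>v. v \<in> V \<Longrightarrow> prec_A C le A u v" for u V
      by (rule I) (rule quotient.R_linf[OF q that(2,1,3) D[OF that(4)]])
  qed
qed

lemma prec_A_top:
  "a \<in> A \<Longrightarrow> prec_A C le A (lsup C le C) a"
  by (simp add: prec_A_def)

lemma prec_A_least:
  "prec_A C le A u v \<Longrightarrow> cong_preorder C le R \<Longrightarrow> (\<And>a. a \<in> A \<Longrightarrow> R (lsup C le C) a) \<Longrightarrow> R u v"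
  unfolding prec_A_def by metis

text \<open>Preserving membership in \<open>P\<close> is itself a congruence preorder: complete
  primeness gives the clause for joins, the filter property the one for meets. As
  \<open>A \<subseteq> P\<close>, it puts the top below \<open>A\<close> and so contains
  \<open>prec_A\<close>.\<close>

lemma prec_A_cp_filter:
  assumes "P \<in> cp_filters C le" "A \<subseteq> P" "prec_A C le A u v" "u \<in> P"
  shows "v \<in> P"
proof -
  note P = cp_filtersD[OF assms(1)]
  let ?R = "\<lambda>u v. u \<in> C \<and> v \<in> C \<and> (u \<in> P \<longrightarrow> v \<in> P)"
  have "cong_preorder C le ?R"
  proof (rule cong_preorderI)
    show "?R (lsup C le S) v" if "S \<subseteq> C" "v \<in> C" "\<And>u. u \<in> S \<Longrightarrow> ?R u v" for S v
      using that P(4)[of S] lsup_closed by auto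
    show "?R u (linf C le V)" if "u \<in> C" "V \<subseteq> C" "finite V" "\<And>v. v \<in> V \<Longrightarrow> ?R u v" for u V
      using that P(3)[of V] linf_closed by auto
  qed (use P(2) in auto)
  then have "?R u v"
    using prec_A_least[OF assms(3)] assms(2) lsup_carrier P(1) by blast
  then show ?thesis using assms(4) by simp
qed

text \<open>A point contains the top, so closure under \<open>prec_A\<close> forces every element of
  \<open>A\<close> into it; the converse is \<open>prec_A_cp_filter\<close>.\<close>

lemma R_closed_pts_prec_A:
  assumes "A \<subseteq> C"
  shows "quotient.R_closed_pts C le (prec_A C le A) = {P \<in> cp_filters C le. A \<subseteq> P}"
proof -
  interpret q: quotient C le "prec_A C le A"
    using cong_preorder_prec_A[OF assms] by unfold_locales
  have "A \<subseteq> P" if "P \<in> q.R_closed_pts" for P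
    using that prec_A_top lsup_carrier_in_cp_filter[of P] by (auto simp: q.R_closed_pts_def)
  moreover have "P \<in> q.R_closed_pts" if "P \<in> cp_filters C le" "A \<subseteq> P" for P
    using that prec_A_cp_filter[OF that] by (auto simp: q.R_closed_pts_def)
  ultimately show ?thesis using q.R_closed_pts_def by auto
qed

end

subsection \<open>Scott-open filters\<close>

definition scott_filter :: "'l set \<Rightarrow> ('l \<Rightarrow> 'l \<Rightarrow> bool) \<Rightarrow> 'l set \<Rightarrow> bool" where
  "scott_filter C le F \<longleftrightarrow> F \<subseteq> C \<and> F \<noteq> {} \<and>
     (\<forall>x\<in>F. \<forall>y\<in>C. le x y \<longrightarrow> y \<in> F) \<and>
     (\<forall>x\<in>F. \<forall>y\<in>F. \<exists>z\<in>F. le z x \<and> le z y) \<and>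
     (\<forall>D s. directed_on C le D \<and> is_lub C le D s \<and> s \<in> F \<longrightarrow> (\<exists>d\<in>D. d \<in> F))"

lemma scott_filterI:
  assumes "F \<subseteq> C" "F \<noteq> {}"
    and "\<And>x y. x \<in> F \<Longrightarrow> y \<in> C \<Longrightarrow> le x y \<Longrightarrow> y \<in> F"
    and "\<And>x y. x \<in> F \<Longrightarrow> y \<in> F \<Longrightarrow> \<exists>z\<in>F. le z x \<and> le z y"
    and "\<And>D s. directed_on C le D \<Longrightarrow> is_lub C le D s \<Longrightarrow> s \<in> F \<Longrightarrow> \<exists>d\<in>D. d \<in> F"
  shows "scott_filter C le F"
  unfolding scott_filter_def
  by (intro conjI ballI allI impI; (elim conjE)?) (rule assms; assumption)+

lemma scott_filterD:
  assumes "scott_filter C le F"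
  shows "F \<subseteq> C" "F \<noteq> {}"
    and "\<And>x y. x \<in> F \<Longrightarrow> y \<in> C \<Longrightarrow> le x y \<Longrightarrow> y \<in> F"
    and "\<And>x y. x \<in> F \<Longrightarrow> y \<in> F \<Longrightarrow> \<exists>z\<in>F. le z x \<and> le z y"
    and "\<And>D s. directed_on C le D \<Longrightarrow> is_lub C le D s \<Longrightarrow> s \<in> F \<Longrightarrow> \<exists>d\<in>D. d \<in> F"
  using assms unfolding scott_filter_def by meson+

context poset
begin

lemma descending_chain_bound:
  assumes "\<And>n. f n \<in> C" "\<And>n. f (Suc n) \<sqsubseteq> f n"
  shows "m \<le> n \<Longrightarrow> f n \<sqsubseteq> f m"
proof (induction n rule: dec_induct)
  case base
  then show ?case using assms refl by simp
next
  case (step n)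
  then show ?case using trans[OF assms(2)[of n]] assms(1) by simp
qed

text \<open>Common to the chains descending along way-below and those descending along
  totally-below.\<close>

lemma chain_up_closure_filter:
  assumes "\<And>n. f n \<in> C" "\<And>n. f (Suc n) \<sqsubseteq> f n"
  defines "F \<equiv> {x\<in>C. \<exists>n. f n \<sqsubseteq> x}"
  shows "F \<subseteq> C" "\<And>n. f n \<in> F"
    "\<And>x y. x \<in> F \<Longrightarrow> y \<in> C \<Longrightarrow> x \<sqsubseteq> y \<Longrightarrow> y \<in> F"
    "\<And>x y. x \<in> F \<Longrightarrow> y \<in> F \<Longrightarrow> \<exists>z\<in>F. z \<sqsubseteq> x \<and> z \<sqsubseteq> y"
proof -
  show "F \<subseteq> C" by (auto simp: F_def)
  show fF: "f n \<in> F" for n using assms(1) refl by (auto simp: F_def)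
  show "y \<in> F" if xy: "x \<in> F" "y \<in> C" "x \<sqsubseteq> y" for x y
  proof -
    obtain n where "f n \<sqsubseteq> x" "x \<in> C" using xy(1) by (auto simp: F_def)
    then have "f n \<sqsubseteq> y" using trans[of "f n" x y] assms(1) xy by simp
    then show ?thesis using xy(2) by (auto simp: F_def)
  qed
  show "\<exists>z\<in>F. z \<sqsubseteq> x \<and> z \<sqsubseteq> y" if xy: "x \<in> F" "y \<in> F" for x y
  proof -
    obtain m n where mn: "f m \<sqsubseteq> x" "x \<in> C" "f n \<sqsubseteq> y" "y \<in> C" using xy by (auto simp: F_def)
    have "f (max m n) \<sqsubseteq> f m" "f (max m n) \<sqsubseteq> f n"
      using descending_chain_bound[of f, OF assms(1,2)] by simp_all
    then have "f (max m n) \<sqsubseteq> x" "f (max m n) \<sqsubseteq> y"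
      using mn assms(1) trans by blast+
    then show ?thesis using fF by blast
  qed
qed

text \<open>One step of the chain pays for one directed supremum: if the supremum is above
  \<open>f n\<close>, a member is already above \<open>f (Suc n)\<close>.\<close>

lemma scott_filter_chain:
  assumes "\<And>n. f n \<in> C" "\<And>n. way_below C le (f (Suc n)) (f n)"
  shows "scott_filter C le {x\<in>C. \<exists>n. f n \<sqsubseteq> x}" (is "scott_filter C le ?F")
proof -
  have desc: "f (Suc n) \<sqsubseteq> f n" for n
    using way_below_imp_le assms by simp
  note F = chain_up_closure_filter[of f, OF assms(1) desc]
  have "\<exists>d\<in>D. d \<in> ?F" if D: "directed_on C le D" "is_lub C le D s" "s \<in> ?F" for D s
  proof -
    obtain n where "f n \<sqsubseteq> s" using D(3) by blast
    then obtain d where "d \<in> D" "f (Suc n) \<sqsubseteq> d"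
      using assms(2)[of n] D unfolding way_below_def by blast
    moreover have "D \<subseteq> C" using D(1) by (simp add: directed_on_def)
    ultimately show ?thesis by blast
  qed
  moreover have "?F \<noteq> {}" using F(2) by blast
  ultimately show ?thesis
    using F(1,3,4) by (intro scott_filterI)
qed

end

section \<open>Separation of points from Scott-open filters, and spatiality of the quotient\<close>

context clat
begin

text \<open>The meet on the left is \<open>m\<close> joined with the meet of \<open>x\<close> and
  \<open>y\<close>. Only the law for a meet over a join is given, so it is applied twice.\<close>

lemma distrib_prime_step:
  assumes "distributive_on C le" "x \<in> C" "y \<in> C" "m \<in> C" "linf C le {x, y} \<sqsubseteq> m"
  shows "linf C le {lsup C le {m, x}, lsup C le {m, y}} \<sqsubseteq> m"
proof -
  let ?mx = "lsup C le {m, x}"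
  have c: "?mx \<in> C" using assms lsup_closed by simp
  have 1: "linf C le {?mx, m} \<sqsubseteq> m"
    using linf_lower[of "{?mx, m}" m] c assms by simp
  have "linf C le {?mx, y} = linf C le {y, ?mx}" by (simp add: insert_commute)
  also have "\<dots> = lsup C le {linf C le {y, m}, linf C le {y, x}}"
    using assms(1,2,3,4) unfolding distributive_on_def by blast
  also have "\<dots> \<sqsubseteq> m"
  proof (rule lsup_least)
    show "s \<sqsubseteq> m" if "s \<in> {linf C le {y, m}, linf C le {y, x}}" for s
      using that linf_lower[of "{y,m}" m] assms by (auto simp: insert_commute)
  qed (use assms linf_closed in auto)
  finally have 2: "linf C le {?mx, y} \<sqsubseteq> m" .
  have "linf C le {?mx, lsup C le {m, y}} = lsup C le {linf C le {?mx, m}, linf C le {?mx, y}}"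
    using assms(1,3,4) c unfolding distributive_on_def by blast
  also have "\<dots> \<sqsubseteq> m"
    by (rule lsup_least) (use 1 2 assms c linf_closed in auto)
  finally show ?thesis .
qed

text \<open>The complement of a Scott-open filter is closed under directed suprema, so Zorn's lemma
  provides an element maximal outside the filter; by distributivity it is prime.\<close>

lemma scott_filter_separation:
  assumes dist: "distributive_on C le" and F: "scott_filter C le F" and w: "w \<in> C" "w \<notin> F"
  shows "\<exists>P\<in>cp_filters C le. F \<subseteq> P \<and> w \<notin> P"
proof -
  note FC = scott_filterD(1,2)[OF F] and up = scott_filterD(3)[OF F]
    and filt = scott_filterD(4)[OF F] and scott = scott_filterD(5)[OF F]
  let ?A = "{x \<in> C. w \<sqsubseteq> x \<and> x \<notin> F}"
  have "\<exists>m\<in>?A. \<forall>a\<in>?A. m \<sqsubseteq> a \<longrightarrow> a = m"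
  proof (rule predicate_Zorn)
    show "partial_order_on ?A (relation_of (\<sqsubseteq>) ?A)"
      by (rule partial_order_on_relation_ofI) (auto intro: refl trans antisym)
    fix K assume K: "K \<in> Chains (relation_of (\<sqsubseteq>) ?A)"
    then have KA: "K \<subseteq> ?A" and lin: "\<And>x y. x \<in> K \<Longrightarrow> y \<in> K \<Longrightarrow> x \<sqsubseteq> y \<or> y \<sqsubseteq> x"
      unfolding Chains_def relation_of_def by blast+
    show "\<exists>u\<in>?A. \<forall>a\<in>K. a \<sqsubseteq> u"
    proof (cases "K = {}")
      case True
      then show ?thesis using w refl by auto
    next
      case False
      have KC: "K \<subseteq> C" using KA by blast
      have "\<exists>z\<in>K. x \<sqsubseteq> z \<and> y \<sqsubseteq> z" if "x \<in> K" "y \<in> K" for x y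
        using lin[OF that] refl that KC by blast
      then have dir: "directed_on C le K" using False KC by (simp add: directed_on_def)
      have "lsup C le K \<notin> F"
        using scott[OF dir lsup_lub[OF KC]] KA by blast
      moreover have "w \<sqsubseteq> lsup C le K"
      proof -
        obtain k where "k \<in> K" using False by blast
        then have "w \<sqsubseteq> k" "k \<sqsubseteq> lsup C le K" "k \<in> C" using KA KC lsup_upper by auto
        then show ?thesis using trans w lsup_closed[OF KC] by blast
      qed
      ultimately show ?thesis using lsup_closed[OF KC] lsup_upper[OF KC] by blast
    qed
  qed
  then obtain m where m: "m \<in> C" "w \<sqsubseteq> m" "m \<notin> F"
    and max: "\<And>a. a \<in> C \<Longrightarrow> w \<sqsubseteq> a \<Longrightarrow> a \<notin> F \<Longrightarrow> m \<sqsubseteq> a \<Longrightarrow> a = m"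
    by blast
  \<comment> \<open>The complement of a principal ideal satisfies the condition on joins for any
    \<open>m\<close>; closure under meets is where primeness of \<open>m\<close> enters.\<close>
  let ?P = "{x \<in> C. \<not> x \<sqsubseteq> m}"
  \<comment> \<open>By maximality, whatever lies strictly above \<open>m\<close> is in
    \<open>F\<close>.\<close>
  have join: "lsup C le {m, x} \<in> F" if x: "x \<in> C" "\<not> x \<sqsubseteq> m" for x
  proof (rule ccontr)
    assume nF: "lsup C le {m, x} \<notin> F"
    have c: "lsup C le {m, x} \<in> C" "m \<sqsubseteq> lsup C le {m, x}" "x \<sqsubseteq> lsup C le {m, x}"
      using lsup_closed[of "{m,x}"] lsup_upper[of "{m,x}"] x m by auto
    then have "w \<sqsubseteq> lsup C le {m, x}" using trans m w by blast
    then show False using max[OF c(1) _ nF c(2)] c(3) x by simp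
  qed
  have "F \<subseteq> ?P" using FC up m by blast
  moreover have "?P \<in> cp_filters C le"
  proof (rule cp_filtersI)
    show "?P \<noteq> {}" using \<open>F \<subseteq> ?P\<close> FC by blast
    show "y \<in> ?P" if "x \<in> ?P" "y \<in> C" "x \<sqsubseteq> y" for x y
      using that trans[of x y m] m by blast
    show "\<exists>s\<in>S. s \<in> ?P" if "S \<subseteq> C" "lsup C le S \<in> ?P" for S
      using that lsup_least[of S m] m by blast
    show "\<exists>z\<in>?P. z \<sqsubseteq> x \<and> z \<sqsubseteq> y" if xy: "x \<in> ?P" "y \<in> ?P" for x y
    proof (intro bexI conjI)
      have c: "{x, y} \<subseteq> C" using xy by auto
      show "linf C le {x, y} \<sqsubseteq> x" "linf C le {x, y} \<sqsubseteq> y" using linf_lower[OF c] by simp_all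
      have "\<not> linf C le {x, y} \<sqsubseteq> m"
      proof
        assume "linf C le {x, y} \<sqsubseteq> m"
        then have le: "linf C le {lsup C le {m, x}, lsup C le {m, y}} \<sqsubseteq> m"
          using distrib_prime_step[OF dist] xy m by simp
        obtain z where z: "z \<in> F" "z \<sqsubseteq> lsup C le {m, x}" "z \<sqsubseteq> lsup C le {m, y}"
          using filt[OF join join] xy by blast
        have c2: "{lsup C le {m, x}, lsup C le {m, y}} \<subseteq> C" using xy m lsup_closed by simp
        have "z \<sqsubseteq> linf C le {lsup C le {m, x}, lsup C le {m, y}}"
          by (rule linf_greatest[OF c2]) (use z FC in auto)
        then have "z \<sqsubseteq> m" using trans[OF _ le] z FC m linf_closed[OF c2] by blast
        then show False using up z m by blast
      qed
      then show "linf C le {x, y} \<in> ?P" using linf_closed[OF c] by simp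
    qed
  qed auto
  moreover have "w \<notin> ?P" using m by simp
  ultimately show ?thesis by blast
qed

text \<open>Modulo \<open>prec_A\<close> every \<open>a\<close> is the top, so \<open>w\<close>
  precedes its meet with \<open>a\<close>. If that meet is below \<open>j\<close>, the join of all
  elements preceding \<open>v\<close>, then \<open>w\<close> precedes \<open>v\<close> too and was
  one of the elements joined.\<close>

lemma prec_A_closure:
  assumes "A \<subseteq> C" "v \<in> C"
  obtains j where "j \<in> C" "prec_A C le A j v" "v \<sqsubseteq> j"
    "\<And>w a. w \<in> C \<Longrightarrow> a \<in> A \<Longrightarrow> linf C le {w, a} \<sqsubseteq> j \<Longrightarrow> w \<sqsubseteq> j"
proof -
  interpret q: quotient C le "prec_A C le A"
    using cong_preorder_prec_A[OF assms(1)] by unfold_locales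
  let ?S = "{w \<in> C. prec_A C le A w v}"
  have S: "?S \<subseteq> C" by blast
  let ?j = "lsup C le ?S"
  have jv: "prec_A C le A ?j v" using q.R_lsup[OF S assms(2)] by blast
  have "w \<sqsubseteq> ?j" if w: "w \<in> C" "a \<in> A" "linf C le {w, a} \<sqsubseteq> ?j" for w a
  proof -
    have a: "{w, a} \<subseteq> C" using w assms by auto
    have "prec_A C le A w (lsup C le C)" using w lsup_carrier q.R_le by simp
    then have "prec_A C le A w a" using prec_A_top[OF w(2)] q.R_trans by blast
    then have "prec_A C le A w (linf C le {w, a})"
      using q.R_linf[OF a w(1)] q.R_refl[OF w(1)] by blast
    moreover have "prec_A C le A (linf C le {w, a}) ?j"
      using w(3) q.R_le linf_closed[OF a] lsup_closed[OF S] by simp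
    ultimately have "prec_A C le A w v" using jv q.R_trans by blast
    then show ?thesis using lsup_upper[OF S] w(1) by simp
  qed
  moreover have "v \<sqsubseteq> ?j" using lsup_upper[OF S] q.R_refl assms(2) by simp
  ultimately show ?thesis using that lsup_closed[OF S] jv by blast
qed

lemma exists_way_below_not_le:
  assumes "continuous_lattice C le" "y \<in> C" "v \<in> C" "\<not> y \<sqsubseteq> v"
  shows "\<exists>x\<in>C. way_below C le x y \<and> \<not> x \<sqsubseteq> v"
  using assms unfolding continuous_lattice_def is_lub_def by blast

text \<open>A Baire category argument: shrinking \<open>u\<close> step by step below the elements of \<open>A\<close> along
  the way-below relation, while staying outside the ideal of elements below \<open>v\<close>, yields a
  Scott-open filter containing \<open>u\<close> and \<open>A\<close>.\<close>

lemma prec_A_spatial: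
  assumes cont: "continuous_lattice C le" and dist: "distributive_on C le"
    and A: "A \<subseteq> C" "countable A" and u: "u \<in> C" and v: "v \<in> C" and n: "\<not> prec_A C le A u v"
  shows "\<exists>P\<in>cp_filters C le. A \<subseteq> P \<and> u \<in> P \<and> v \<notin> P"
proof -
  interpret q: quotient C le "prec_A C le A"
    using cong_preorder_prec_A[OF A(1)] by unfold_locales
  obtain j where j: "j \<in> C" "prec_A C le A j v" "v \<sqsubseteq> j"
    and closed: "\<And>w a. w \<in> C \<Longrightarrow> a \<in> A \<Longrightarrow> linf C le {w, a} \<sqsubseteq> j \<Longrightarrow> w \<sqsubseteq> j"
    using prec_A_closure[OF A(1) v] by blast
  have uj: "\<not> u \<sqsubseteq> j" using n j q.R_le[of u j] q.R_trans u by blast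
  define t where "t = lsup C le C"
  have t: "t \<in> C" "\<And>x. x \<in> C \<Longrightarrow> x \<sqsubseteq> t" using lsup_carrier by (auto simp: t_def)
  \<comment> \<open>\<open>from_nat_into\<close> enumerates a nonempty countable set, and
    \<open>A\<close> may be empty. The top is a harmless addition, since a meet with it changes
    nothing (\<open>closed'\<close>).\<close>
  define a where "a = from_nat_into (insert t A)"
  have a: "a n \<in> insert t A" for n unfolding a_def by (rule from_nat_into) simp
  have aC: "a n \<in> C" for n using a[of n] t A by auto
  have closed': "w \<sqsubseteq> j" if w: "w \<in> C" "linf C le {w, a n} \<sqsubseteq> j" for w and n :: nat
  proof (cases "a n \<in> A")
    case False
    then have "a n = t" using a[of n] by simp
    then have "w \<sqsubseteq> linf C le {w, a n}"
      using linf_greatest[of "{w, a n}" w] w(1) t refl by auto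
    then show ?thesis using trans[OF _ w(2)] w(1) linf_closed[of "{w, a n}"] aC j by simp
  qed (use closed w in blast)
  \<comment> \<open>The conjunct for \<open>n = 0\<close> pins the first term, which
    \<open>dependent_nat_choice\<close> leaves open. \<open>closed'\<close> keeps the meet with
    \<open>a n\<close> outside the ideal of \<open>j\<close>, and continuity finds the next term
    outside it as well.\<close>
  have "\<exists>f. \<forall>n. ((f n \<in> C \<and> \<not> f n \<sqsubseteq> j) \<and> (n = 0 \<longrightarrow> f n = u)) \<and> way_below C le (f (Suc n)) (linf C le {f n, a n})"
  proof (rule dependent_nat_choice)
    show "\<exists>x. (x \<in> C \<and> \<not> x \<sqsubseteq> j) \<and> ((0::nat) = 0 \<longrightarrow> x = u)" using u uj by blast
    fix x and n :: nat assume x: "(x \<in> C \<and> \<not> x \<sqsubseteq> j) \<and> (n = 0 \<longrightarrow> x = u)"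
    then have "linf C le {x, a n} \<in> C" "\<not> linf C le {x, a n} \<sqsubseteq> j"
      using linf_closed[of "{x, a n}"] closed' aC by auto
    then show "\<exists>y. ((y \<in> C \<and> \<not> y \<sqsubseteq> j) \<and> (Suc n = 0 \<longrightarrow> y = u)) \<and> way_below C le y (linf C le {x, a n})"
      using exists_way_below_not_le[OF cont _ j(1)] by blast
  qed
  then obtain f where f: "\<And>n. f n \<in> C" "\<And>n. \<not> f n \<sqsubseteq> j" "f 0 = u"
    and fS: "\<And>n. way_below C le (f (Suc n)) (linf C le {f n, a n})"
    by blast
  have c: "{f n, a n} \<subseteq> C" for n using f aC by simp
  have wb: "way_below C le (f (Suc n)) (f n)" "way_below C le (f (Suc n)) (a n)" for n
    using way_below_mono[OF fS refl linf_lower[OF c]] f aC linf_closed[OF c] by blast+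
  let ?F = "{x\<in>C. \<exists>n. f n \<sqsubseteq> x}"
  have "scott_filter C le ?F" using scott_filter_chain[of f] f(1) wb(1) by simp
  moreover have "j \<notin> ?F" using f(2) by simp
  ultimately obtain P where P: "P \<in> cp_filters C le" "?F \<subseteq> P" "j \<notin> P"
    using scott_filter_separation[OF dist _ j(1)] by blast
  have "u \<in> ?F" using f(3) refl u by auto
  moreover have "x \<in> ?F" if x: "x \<in> A" for x
  proof -
    have "range a = insert t A" unfolding a_def by (rule range_from_nat_into) (use A in auto)
    then obtain n where "x = a n" using x by (metis insertI2 rangeE)
    then have "f (Suc n) \<sqsubseteq> x" using way_below_imp_le[OF wb(2)] aC by simp
    then show ?thesis using x A by blast
  qed
  moreover have "v \<notin> P" using P(1,3) cp_filtersD(2) j by blast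
  ultimately show ?thesis using P by blast
qed

subsection \<open>The space of points\<close>

lemma closure_of_point:
  assumes "P \<in> cp_filters C le"
  shows "pt_top C le closure_of {P} = {P' \<in> cp_filters C le. P' \<subseteq> P}"
proof -
  have "P' \<in> pt_top C le closure_of {P} \<longleftrightarrow> (\<forall>u\<in>C. P' \<in> eps C le u \<longrightarrow> P \<in> eps C le u)"
    if "P' \<in> cp_filters C le" for P'
    using that by (auto simp: in_closure_of topspace_pt_top openin_pt_top)
  then have "P' \<in> pt_top C le closure_of {P} \<longleftrightarrow> P' \<subseteq> P" if "P' \<in> cp_filters C le" for P'
    using that assms cp_filtersD(1)[OF that] by (auto simp: eps_def)
  then show ?thesis
    using closure_of_subset_topspace[of "pt_top C le"] by (auto simp: topspace_pt_top)
qed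

text \<open>The generic point of \<open>S\<close> collects the elements whose basic open set meets
  \<open>S\<close>; irreducibility, applied to the complements of two such sets, closes it under
  meets. As \<open>S\<close> is the complement of \<open>eps C le s\<close>, this point omits
  \<open>s\<close>, and so every point contained in it lies in \<open>S\<close>.\<close>

lemma sober_pt_top: "sober_space (pt_top C le)"
  unfolding sober_space_def
proof (intro allI impI)
  let ?X = "pt_top C le"
  fix S assume S: "closedin ?X S \<and> irreducible_in ?X S"
  then have S0: "S \<noteq> {}" "S \<subseteq> cp_filters C le"
    and irr: "\<And>A B. closedin ?X A \<Longrightarrow> closedin ?X B \<Longrightarrow> S \<subseteq> A \<union> B \<Longrightarrow> S \<subseteq> A \<or> S \<subseteq> B"
    unfolding irreducible_in_def topspace_pt_top by auto
  obtain s where s: "s \<in> C" "S = cp_filters C le - eps C le s" using S closedin_pt_top by blast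
  let ?P = "{x \<in> C. eps C le x \<inter> S \<noteq> {}}"
  have P: "?P \<in> cp_filters C le"
  proof (rule cp_filtersI)
    show "?P \<noteq> {}"
      using S0 lsup_carrier(1) eps_lsup_carrier by blast
    show "y \<in> ?P" if "x \<in> ?P" "y \<in> C" "x \<sqsubseteq> y" for x y
      using that eps_mono[of x y] by blast
    show "\<exists>r\<in>R. r \<in> ?P" if "R \<subseteq> C" "lsup C le R \<in> ?P" for R
      using that eps_lsup[of R] by auto
    show "\<exists>z\<in>?P. z \<sqsubseteq> x \<and> z \<sqsubseteq> y" if xy: "x \<in> ?P" "y \<in> ?P" for x y
    proof (intro bexI conjI)
      have c: "{x, y} \<subseteq> C" using xy by auto
      show "linf C le {x, y} \<sqsubseteq> x" "linf C le {x, y} \<sqsubseteq> y" using linf_lower[OF c] by simp_all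
      have cl: "closedin ?X (cp_filters C le - eps C le z)" if "z \<in> C" for z
        using that closedin_pt_top by blast
      have "eps C le x \<inter> eps C le y \<inter> S \<noteq> {}"
        using irr[OF cl cl, of x y] xy S0(2) by blast
      moreover have "eps C le (linf C le {x, y}) = eps C le x \<inter> eps C le y"
        using eps_linf[OF c] eps_subset by auto
      ultimately show "linf C le {x, y} \<in> ?P" using linf_closed[OF c] by simp
    qed
  qed auto
  have mem: "Q \<in> S \<longleftrightarrow> Q \<subseteq> ?P" if Q: "Q \<in> cp_filters C le" for Q
  proof
    assume "Q \<in> S"
    then show "Q \<subseteq> ?P" using cp_filtersD(1)[OF Q] Q by (auto simp: eps_def)
  next
    assume "Q \<subseteq> ?P"
    then have "s \<notin> Q" using s by blast
    then show "Q \<in> S" using s Q by (simp add: eps_def)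
  qed
  show "\<exists>!x. x \<in> topspace ?X \<and> ?X closure_of {x} = S"
  proof
    show "?P \<in> topspace ?X \<and> ?X closure_of {?P} = S"
      using P mem S0(2) by (auto simp: topspace_pt_top closure_of_point)
    fix Q assume "Q \<in> topspace ?X \<and> ?X closure_of {Q} = S"
    then have Q: "Q \<in> cp_filters C le" "{P' \<in> cp_filters C le. P' \<subseteq> Q} = S"
      using closure_of_point by (auto simp: topspace_pt_top)
    then have "Q \<subseteq> ?P" "?P \<subseteq> Q" using mem P by blast+
    then show "Q = ?P" by blast
  qed
qed

text \<open>\<open>continuous_lattice\<close> asks only for the supremum. Directedness comes from
  finite joins: the bottom is way below everything, and the join of two elements way below
  \<open>y\<close> is again way below \<open>y\<close>.\<close>

lemma continuous_lattice_imp_continuous_dcpo: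
  assumes "continuous_lattice C le"
  shows "continuous_dcpo C le"
  unfolding continuous_dcpo_def dcpo_on_def
proof (intro conjI allI impI ballI)
  show "\<exists>x. is_lub C le D x" if "directed_on C le D" for D
    using that ex_lub by (simp add: directed_on_def)
  show "is_lub C le {x \<in> C. way_below C le x y} y" if "y \<in> C" for y
    using assms that by (simp add: continuous_lattice_def)
  show "directed_on C le {x \<in> C. way_below C le x y}" if y: "y \<in> C" for y
    unfolding directed_on_def
  proof (intro conjI ballI)
    have "way_below C le (lsup C le {}) y"
      unfolding way_below_def directed_on_def using lsup_least[of "{}"] by blast
    then show "{x \<in> C. way_below C le x y} \<noteq> {}" using lsup_closed[of "{}"] by blast
    fix a b assume ab: "a \<in> {x \<in> C. way_below C le x y}" "b \<in> {x \<in> C. way_below C le x y}"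
    then have c: "{a, b} \<subseteq> C" by simp
    have "way_below C le (lsup C le {a, b}) y"
      unfolding way_below_def
    proof (intro allI impI)
      fix D s assume D: "directed_on C le D \<and> is_lub C le D s \<and> y \<sqsubseteq> s"
      then obtain d e where de: "d \<in> D" "a \<sqsubseteq> d" "e \<in> D" "b \<sqsubseteq> e"
        using ab unfolding way_below_def by blast
      then obtain z where z: "z \<in> D" "\<forall>v\<in>{a, b}. v \<sqsubseteq> z"
        using directed_finite_bound[of D "{a, b}"] D c by auto
      then have "z \<in> C" using D by (auto simp: directed_on_def)
      then have "lsup C le {a, b} \<sqsubseteq> z" using lsup_le_iff[OF c] z by simp
      then show "\<exists>d\<in>D. lsup C le {a, b} \<sqsubseteq> d" using z by blast
    qed
    then show "\<exists>z\<in>{x \<in> C. way_below C le x y}. a \<sqsubseteq> z \<and> b \<sqsubseteq> z"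
      using lsup_closed[OF c] lsup_upper[OF c] by blast
  qed auto
qed (rule partial_order)

end

section \<open>Interpolation in continuous dcpos\<close>

locale cont_dcpo = poset +
  assumes cont_dcpo: "continuous_dcpo C le"
begin

lemma way_below_directed: "y \<in> C \<Longrightarrow> directed_on C le {x\<in>C. way_below C le x y}"
  and way_below_lub: "y \<in> C \<Longrightarrow> is_lub C le {x\<in>C. way_below C le x y} y"
  and directed_lub: "directed_on C le D \<Longrightarrow> \<exists>x. is_lub C le D x"
  using cont_dcpo unfolding continuous_dcpo_def dcpo_on_def by simp_all

text \<open>The elements two way-below steps under \<open>y\<close> form a directed set whose
  supremum is still \<open>y\<close>, so anything way below \<open>y\<close> lies under one of
  them.\<close>

lemma way_below_interpolation:
  assumes "way_below C le x y" "x \<in> C" "y \<in> C"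
  shows "\<exists>z\<in>C. way_below C le x z \<and> way_below C le z y"
proof -
  let ?D = "{z\<in>C. \<exists>w\<in>C. way_below C le z w \<and> way_below C le w y}"
  have dir: "directed_on C le ?D"
    unfolding directed_on_def
  proof (intro conjI ballI)
    obtain w where "w \<in> C" "way_below C le w y"
      using way_below_directed[OF assms(3)] by (auto simp: directed_on_def)
    then show "?D \<noteq> {}"
      using way_below_directed[of w] by (auto simp: directed_on_def)
    fix a b assume "a \<in> ?D" "b \<in> ?D"
    then obtain w w' where w: "a \<in> C" "b \<in> C" "w \<in> C" "w' \<in> C" "way_below C le a w" "way_below C le w y"
      "way_below C le b w'" "way_below C le w' y" by blast
    then obtain w'' where w'': "w'' \<in> C" "way_below C le w'' y" "w \<sqsubseteq> w''" "w' \<sqsubseteq> w''"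
      using way_below_directed[OF assms(3)] unfolding directed_on_def by blast
    then have "way_below C le a w''" "way_below C le b w''"
      using way_below_mono w refl by blast+
    then obtain z where "z \<in> C" "way_below C le z w''" "a \<sqsubseteq> z" "b \<sqsubseteq> z"
      using way_below_directed[OF w''(1)] w unfolding directed_on_def by blast
    then show "\<exists>z\<in>?D. a \<sqsubseteq> z \<and> b \<sqsubseteq> z" using w'' by blast
  qed auto
  have "is_lub C le ?D y"
    unfolding is_lub_def
  proof (intro conjI ballI impI)
    show "s \<sqsubseteq> y" if "s \<in> ?D" for s
      using that way_below_imp_le trans assms(3) by blast
    fix b assume b: "b \<in> C" "\<forall>s\<in>?D. s \<sqsubseteq> b"
    have "w \<sqsubseteq> b" if "w \<in> C" "way_below C le w y" for w
      using way_below_lub[OF that(1)] that b unfolding is_lub_def by blast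
    then show "y \<sqsubseteq> b" using way_below_lub[OF assms(3)] b(1) unfolding is_lub_def by blast
  qed (rule assms(3))
  then obtain z where z: "z \<in> ?D" "x \<sqsubseteq> z"
    using assms(1) dir refl[OF assms(3)] unfolding way_below_def by blast
  then obtain w where "w \<in> C" "way_below C le z w" "way_below C le w y" by blast
  then show ?thesis using way_below_mono[OF _ z(2) refl] assms z(1) by blast
qed

end

section \<open>Compact saturated sets of points, and the points of the quotient as a countable
  intersection\<close>

context clat
begin

text \<open>The points containing a given Scott-open filter form a compact saturated set, as in the
  Hofmann--Mislove theorem; these are the neighbourhoods that make the space of points locally
  compact.\<close>

lemma scott_filter_compact:
  assumes dist: "distributive_on C le" and F: "scott_filter C le F"
  defines "K \<equiv> {P \<in> cp_filters C le. F \<subseteq> P}"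
  shows "compactin (pt_top C le) K" "saturated_in (pt_top C le) K"
proof -
  note FC = scott_filterD(1)[OF F] and scott = scott_filterD(5)[OF F]
  have HM: "K \<subseteq> eps C le w \<longleftrightarrow> w \<in> F" if "w \<in> C" for w
    using scott_filter_separation[OF dist F that] by (auto simp: K_def eps_def)
  show "compactin (pt_top C le) K"
    unfolding compactin_def topspace_pt_top
  proof (intro conjI allI impI)
    show "K \<subseteq> cp_filters C le" by (auto simp: K_def)
    fix \<U> assume U: "Ball \<U> (openin (pt_top C le)) \<and> K \<subseteq> \<Union>\<U>"
    let ?W = "{w\<in>C. eps C le w \<in> \<U>}"
    have W: "?W \<subseteq> C" by blast
    have "\<Union>\<U> \<subseteq> \<Union>(eps C le ` ?W)"
    proof
      fix P assume "P \<in> \<Union>\<U>"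
      then obtain T where T: "T \<in> \<U>" "P \<in> T" by blast
      then obtain w where "w \<in> C" "T = eps C le w" using U openin_pt_top by blast
      then show "P \<in> \<Union>(eps C le ` ?W)" using T by blast
    qed
    then have "K \<subseteq> eps C le (lsup C le ?W)" using U eps_lsup[OF W] by blast
    then have "lsup C le ?W \<in> F" using HM lsup_closed[OF W] by blast
    then obtain V where V: "V \<subseteq> ?W" "finite V" "lsup C le V \<in> F"
      using scott[OF directed_finite_lsups[OF W]] by blast
    have VC: "V \<subseteq> C" using V W by blast
    have "K \<subseteq> \<Union>(eps C le ` V)" using HM[OF lsup_closed[OF VC]] V(3) eps_lsup[OF VC] by blast
    then show "\<exists>\<F>. finite \<F> \<and> \<F> \<subseteq> \<U> \<and> K \<subseteq> \<Union>\<F>"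
      using V by (intro exI[of _ "eps C le ` V"]) auto
  qed
  show "saturated_in (pt_top C le) K"
    unfolding saturated_in_def topspace_pt_top
  proof (intro conjI equalityI subsetI)
    fix P assume P: "P \<in> cp_filters C le \<inter> \<Inter> {U. openin (pt_top C le) U \<and> K \<subseteq> U}"
    have "w \<in> P" if "w \<in> F" for w
    proof -
      have "openin (pt_top C le) (eps C le w)" "K \<subseteq> eps C le w"
        using that FC HM openin_pt_top by blast+
      then show ?thesis using P by (auto simp: eps_def)
    qed
    then show "P \<in> K" using P by (auto simp: K_def)
  qed (auto simp: K_def)
qed

lemma lc_sober_pt_top:
  assumes cont: "continuous_lattice C le" and dist: "distributive_on C le"
  shows "lc_sober (pt_top C le)"
  unfolding lc_sober_def locally_compact_sat_def
proof (intro conjI sober_pt_top ballI allI impI)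
  interpret cont_dcpo C le
    using continuous_lattice_imp_continuous_dcpo[OF cont] by unfold_locales
  fix P U assume P: "P \<in> topspace (pt_top C le)" and "openin (pt_top C le) U \<and> P \<in> U"
  then obtain u where u: "u \<in> C" "U = eps C le u" "u \<in> P" by (auto simp: openin_pt_top eps_def)
  have Pc: "P \<in> cp_filters C le" using P by (simp add: topspace_pt_top)
  have "lsup C le {x\<in>C. way_below C le x u} = u"
    using way_below_lub[OF u(1)] lsup_eq by blast
  then obtain v where v: "v \<in> C" "way_below C le v u" "v \<in> P"
    using cp_filtersD(4)[OF Pc, of "{x\<in>C. way_below C le x u}"] u by auto
  \<comment> \<open>Interpolation keeps the whole chain above \<open>v\<close>, which gives
    \<open>eps C le v \<subseteq> ?K\<close>; the start at \<open>u\<close> gives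
    \<open>?K \<subseteq> U\<close>.\<close>
  have "\<exists>f. \<forall>n. ((f n \<in> C \<and> way_below C le v (f n)) \<and> (n = 0 \<longrightarrow> f n = u)) \<and> way_below C le (f (Suc n)) (f n)"
  proof (rule dependent_nat_choice)
    show "\<exists>x. (x \<in> C \<and> way_below C le v x) \<and> ((0::nat) = 0 \<longrightarrow> x = u)" using u v by blast
    fix x and n :: nat assume "(x \<in> C \<and> way_below C le v x) \<and> (n = 0 \<longrightarrow> x = u)"
    then show "\<exists>y. ((y \<in> C \<and> way_below C le v y) \<and> (Suc n = 0 \<longrightarrow> y = u)) \<and> way_below C le y x"
      using way_below_interpolation[of v x] v by blast
  qed
  then obtain f where f: "\<And>n. f n \<in> C" "\<And>n. way_below C le v (f n)" "f 0 = u"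
    "\<And>n. way_below C le (f (Suc n)) (f n)" by blast
  let ?F = "{x\<in>C. \<exists>n. f n \<sqsubseteq> x}"
  have F: "scott_filter C le ?F" using scott_filter_chain[of f] f by simp
  have vF: "v \<sqsubseteq> x" if "x \<in> ?F" for x
    using that way_below_imp_le[OF f(2) f(1)] trans[of v _ x] v f(1) by blast
  let ?K = "{P \<in> cp_filters C le. ?F \<subseteq> P}"
  have "eps C le v \<subseteq> ?K"
    using vF cp_filtersD(2)[of _ v] by (auto simp: eps_def)
  moreover have "u \<in> ?F" using f(3) refl u by auto
  then have "?K \<subseteq> U" using u by (auto simp: eps_def)
  moreover have "P \<in> eps C le v" using Pc v by (simp add: eps_def)
  ultimately show "\<exists>V K. openin (pt_top C le) V \<and> compactin (pt_top C le) K \<and>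
      saturated_in (pt_top C le) K \<and> P \<in> V \<and> V \<subseteq> K \<and> K \<subseteq> U"
    using scott_filter_compact[OF dist F] v(1)
    by (intro exI[of _ "eps C le v"] exI[of _ ?K] conjI) (auto simp: openin_pt_top)
qed

lemma gdelta_points_containing:
  assumes "A \<subseteq> C" "countable A"
  shows "gdelta_in (pt_top C le) {P \<in> cp_filters C le. A \<subseteq> P}"
proof -
  \<comment> \<open>The top contributes the whole space, which keeps the intersection inside it when
    \<open>A\<close> is empty.\<close>
  let ?T = "eps C le ` insert (lsup C le C) A"
  have "\<Inter>?T = {P \<in> cp_filters C le. A \<subseteq> P}"
    using eps_lsup_carrier by (auto simp: eps_def)
  moreover have "gdelta_in (pt_top C le) (\<Inter>?T)"
  proof (rule gdelta_in_Inter)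
    show "gdelta_in (pt_top C le) S" if "S \<in> ?T" for S
      using that assms lsup_carrier open_imp_gdelta_in openin_pt_top by blast
  qed (use assms in auto)
  ultimately show ?thesis by simp
qed

lemma pt_quotient_homeomorphic:
  assumes "A \<subseteq> C"
  shows "pt_top (quot_carrier C (prec_A C le A)) (quot_le (prec_A C le A))
    homeomorphic_space subtopology (pt_top C le) {P \<in> cp_filters C le. A \<subseteq> P}"
proof -
  interpret q: quotient C le "prec_A C le A"
    using cong_preorder_prec_A[OF assms] by unfold_locales
  show ?thesis
    using q.homeomorphic_map_pull unfolding R_closed_pts_prec_A[OF assms]
    by (rule homeomorphic_map_imp_homeomorphic_space)
qed

text \<open>The separating point from \<open>prec_A_spatial\<close> contains \<open>A\<close>, so it
  is closed under \<open>prec_A\<close> and descends along \<open>cls\<close>. Being a union of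
  classes, it still separates after descending.\<close>

lemma eps_frame_iso_quotient:
  assumes "continuous_lattice C le" "distributive_on C le" "A \<subseteq> C" "countable A"
  defines "Q \<equiv> quot_carrier C (prec_A C le A)" and "le_Q \<equiv> quot_le (prec_A C le A)"
  shows "frame_iso Q le_Q (opens (pt_top Q le_Q)) (\<subseteq>) (eps Q le_Q)"
proof -
  interpret q: quotient C le "prec_A C le A"
    using cong_preorder_prec_A[OF assms(3)] by unfold_locales
  show ?thesis
    unfolding Q_def le_Q_def
  proof (rule q.quot.eps_frame_iso)
    fix x y assume xy: "x \<in> q.Q" "y \<in> q.Q" "\<not> q.le_Q x y"
    then obtain u v where uv: "u \<in> C" "v \<in> C" "x = q.cls u" "y = q.cls v"
      unfolding q.quot_carrier_eq by blast
    then obtain P where P: "P \<in> cp_filters C le" "A \<subseteq> P" "u \<in> P" "v \<notin> P"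
      using prec_A_spatial[OF assms(1-4)] xy(3) q.quot_le_cls by blast
    then have "P \<in> q.R_closed_pts" using R_closed_pts_prec_A[OF assms(3)] by blast
    note P' = q.cls_image_in[OF this]
    have "y \<notin> q.cls ` P"
      using P(4) P'(2) uv by (auto simp: q.pull_def)
    then show "\<exists>P\<in>cp_filters q.Q q.le_Q. x \<in> P \<and> y \<notin> P"
      using P'(1) P(3) uv(3) by blast
  qed
qed

end

subsection \<open>Frames of open sets\<close>

lemma mem_opens: "U \<in> opens X \<longleftrightarrow> openin X U"
  by (simp add: opens_def)

lemma subset_opens_iff: "S \<subseteq> opens X \<longleftrightarrow> (\<forall>U\<in>S. openin X U)"
  by (auto simp: opens_def)

lemma opens_is_lub: "\<S> \<subseteq> opens X \<Longrightarrow> is_lub (opens X) (\<subseteq>) \<S> (\<Union>\<S>)"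
  by (auto simp: is_lub_def opens_def)

lemma clat_opens: "clat (opens X) (\<subseteq>)"
proof
  show "partial_order_on' (opens X) (\<subseteq>)" by (auto simp: partial_order_on'_def)
  show "\<exists>x. is_lub (opens X) (\<subseteq>) S x" if "S \<subseteq> opens X" for S
    using opens_is_lub[OF that] by blast
qed

lemma lsup_opens: "\<S> \<subseteq> opens X \<Longrightarrow> lsup (opens X) (\<subseteq>) \<S> = \<Union>\<S>"
proof -
  interpret clat "opens X" "(\<subseteq>)" by (rule clat_opens)
  show "\<S> \<subseteq> opens X \<Longrightarrow> lsup (opens X) (\<subseteq>) \<S> = \<Union>\<S>"
    using lsup_eq opens_is_lub by blast
qed

text \<open>The intersection of the empty family is the whole type, hence the factor
  \<open>topspace X\<close>; infinite intersections need not be open, hence the interior.\<close>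

lemma linf_opens: "\<S> \<subseteq> opens X \<Longrightarrow> linf (opens X) (\<subseteq>) \<S> = X interior_of (topspace X \<inter> \<Inter>\<S>)"
proof -
  interpret clat "opens X" "(\<subseteq>)" by (rule clat_opens)
  assume "\<S> \<subseteq> opens X"
  then have "is_glb (opens X) (\<subseteq>) \<S> (X interior_of (topspace X \<inter> \<Inter>\<S>))"
    unfolding is_glb_def
  proof (intro conjI ballI impI)
    fix V assume V: "V \<in> opens X" "\<forall>s\<in>\<S>. V \<subseteq> s"
    then have "openin X V" "V \<subseteq> topspace X \<inter> \<Inter>\<S>" using openin_subset by (auto simp: mem_opens)
    then show "V \<subseteq> X interior_of (topspace X \<inter> \<Inter>\<S>)" by (simp add: interior_of_maximal)
  qed (use interior_of_subset[of X "topspace X \<inter> \<Inter>\<S>"] in \<open>auto simp: mem_opens\<close>)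
  then show ?thesis using linf_eq by blast
qed

lemma linf_opens_finite:
  assumes "\<S> \<subseteq> opens X" "finite \<S>"
  shows "linf (opens X) (\<subseteq>) \<S> = topspace X \<inter> \<Inter>\<S>"
proof (cases "\<S> = {}")
  case True
  then show ?thesis using linf_opens[of "{}"] by (simp add: interior_of_topspace)
next
  case False
  then have "openin X (\<Inter>\<S>)" using assms by (intro openin_Inter) (auto simp: mem_opens)
  then show ?thesis
    using linf_opens[OF assms(1)] by (simp add: interior_of_openin openin_Int)
qed

lemma opens_distributive: "distributive_on (opens X) (\<subseteq>)"
proof -
  have "a \<inter> b \<in> opens X" "a \<union> b \<in> opens X" "topspace X \<inter> (a \<inter> b) = a \<inter> b"
    if "a \<in> opens X" "b \<in> opens X" for a b
    using that openin_subset[of X a] by (auto simp: mem_opens openin_Un)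
  then show ?thesis
    unfolding distributive_on_def by (simp add: lsup_opens linf_opens_finite Int_Un_distrib)
qed

section \<open>The unit \<open>eta\<close> and sobriety\<close>

lemma eta_in_cp_filters:
  assumes "x \<in> topspace X"
  shows "eta X x \<in> cp_filters (opens X) (\<subseteq>)"
proof -
  interpret clat "opens X" "(\<subseteq>)" by (rule clat_opens)
  show ?thesis
  proof (rule cp_filtersI)
    show "eta X x \<noteq> {}" using assms by (auto simp: eta_def)
    show "\<exists>z\<in>eta X x. z \<subseteq> U \<and> z \<subseteq> V" if "U \<in> eta X x" "V \<in> eta X x" for U V
      using that by (intro bexI[of _ "U \<inter> V"]) (auto simp: eta_def)
    show "\<exists>s\<in>S. s \<in> eta X x" if "S \<subseteq> opens X" "lsup (opens X) (\<subseteq>) S \<in> eta X x" for S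
      using that by (auto simp: lsup_opens eta_def subset_opens_iff)
  qed (auto simp: eta_def mem_opens)
qed

text \<open>The inverse image of \<open>eps (opens X) (\<subseteq>) W\<close> under
  \<open>eta X\<close> is \<open>W\<close>, so open sets always correspond and only bijectivity can
  fail.\<close>

lemma homeomorphic_map_eta:
  assumes "bij_betw (eta X) (topspace X) (cp_filters (opens X) (\<subseteq>))"
  shows "homeomorphic_map X (pt_top (opens X) (\<subseteq>)) (eta X)"
proof -
  interpret clat "opens X" "(\<subseteq>)" by (rule clat_opens)
  let ?pt = "cp_filters (opens X) (\<subseteq>)"
  have im: "eta X ` topspace X = ?pt" and inj: "inj_on (eta X) (topspace X)"
    using assms by (auto simp: bij_betw_def)
  have pre: "{x \<in> topspace X. eta X x \<in> eps (opens X) (\<subseteq>) W} = W" if "openin X W" for W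
    using that openin_subset[OF that] eta_in_cp_filters[of _ X] by (auto simp: eps_def eta_def)
  have "openin X {x \<in> topspace X. eta X x \<in> U} \<longleftrightarrow> openin (pt_top (opens X) (\<subseteq>)) U" if U: "U \<subseteq> ?pt" for U
  proof
    assume W: "openin X {x \<in> topspace X. eta X x \<in> U}" (is "openin X ?W")
    have "eta X x \<in> eps (opens X) (\<subseteq>) ?W \<longleftrightarrow> eta X x \<in> U" if "x \<in> topspace X" for x
      using that W eta_in_cp_filters by (auto simp: eps_def eta_def)
    moreover have "eps (opens X) (\<subseteq>) ?W \<subseteq> eta X ` topspace X" "U \<subseteq> eta X ` topspace X"
      unfolding im using U by (auto simp: eps_def)
    ultimately have "U = eps (opens X) (\<subseteq>) ?W" by blast
    moreover have "?W \<in> opens X" using W by (simp add: mem_opens)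
    ultimately show "openin (pt_top (opens X) (\<subseteq>)) U" unfolding openin_pt_top by blast
  next
    assume "openin (pt_top (opens X) (\<subseteq>)) U"
    then obtain W where "openin X W" "U = eps (opens X) (\<subseteq>) W"
      by (auto simp: openin_pt_top mem_opens)
    then show "openin X {x \<in> topspace X. eta X x \<in> U}" using pre by simp
  qed
  then show ?thesis
    unfolding homeomorphic_map_def quotient_map_def topspace_pt_top using im inj by blast
qed

text \<open>A completely prime filter omits a largest open set \<open>?N\<close>. Closure under
  meets makes the complement of \<open>?N\<close> irreducible, and the open neighbourhoods of its
  generic point are exactly the filter. Injectivity is uniqueness of generic points.\<close>

lemma sober_eta_bij:
  assumes "sober_space X"
  shows "bij_betw (eta X) (topspace X) (cp_filters (opens X) (\<subseteq>))"
proof -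
  interpret clat "opens X" "(\<subseteq>)" by (rule clat_opens)
  have cl: "y \<in> X closure_of {x} \<longleftrightarrow> y \<in> topspace X \<and> eta X y \<subseteq> eta X x" if "x \<in> topspace X" for x y
    by (auto simp: in_closure_of eta_def)
  have irr: "irreducible_in X (X closure_of {x})" if x: "x \<in> topspace X" for x
    unfolding irreducible_in_def
  proof (intro conjI allI impI)
    show "X closure_of {x} \<noteq> {}" using cl[OF x, of x] x by blast
    show "X closure_of {x} \<subseteq> topspace X" by (rule closure_of_subset_topspace)
    fix A B assume AB: "closedin X A \<and> closedin X B \<and> X closure_of {x} \<subseteq> A \<union> B"
    then have "x \<in> A \<or> x \<in> B" using cl[OF x, of x] x by blast
    then show "X closure_of {x} \<subseteq> A \<or> X closure_of {x} \<subseteq> B"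
      using AB closure_of_minimal[of "{x}" _ X] by blast
  qed
  have "inj_on (eta X) (topspace X)"
  proof (rule inj_onI)
    fix x y assume xy: "x \<in> topspace X" "y \<in> topspace X" "eta X x = eta X y"
    then have "X closure_of {x} = X closure_of {y}" using cl by blast
    moreover have "\<exists>!z. z \<in> topspace X \<and> X closure_of {z} = X closure_of {x}"
      using assms irr[OF xy(1)] unfolding sober_space_def by simp
    ultimately show "x = y" using xy by metis
  qed
  moreover have "P \<in> eta X ` topspace X" if P: "P \<in> cp_filters (opens X) (\<subseteq>)" for P
  proof -
    note PD = cp_filtersD[OF P]
    let ?N = "\<Union>{U. openin X U \<and> U \<notin> P}"
    have No: "openin X ?N" by (rule openin_Union) blast
    have N: "?N \<notin> P"
      using PD(4)[of "{U. openin X U \<and> U \<notin> P}"] lsup_opens[of "{U. openin X U \<and> U \<notin> P}" X]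
      by (auto simp: subset_opens_iff)
    have mem: "U \<in> P \<longleftrightarrow> \<not> U \<subseteq> ?N" if "openin X U" for U
      using that N PD(2)[of U ?N] No by (auto simp: mem_opens)
    have int: "U \<inter> V \<in> P" if "U \<in> P" "V \<in> P" for U V
    proof -
      have "openin X U" using that(1) PD(1) by (auto simp: mem_opens)
      then have "topspace X \<inter> (U \<inter> V) = U \<inter> V" using openin_subset by blast
      then show ?thesis
        using that PD(1) PD(3)[of "{U, V}"] linf_opens_finite[of "{U, V}" X] subsetD[OF PD(1)] by simp
    qed
    have top: "topspace X \<in> P"
      using PD(3)[of "{}"] linf_opens_finite[of "{}" X] by simp
    let ?S = "topspace X - ?N"
    have "closedin X ?S" using No by blast
    moreover have "irreducible_in X ?S"
      unfolding irreducible_in_def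
    proof (intro conjI allI impI)
      show "?S \<noteq> {}" using top mem[of "topspace X"] by auto
      fix A B assume AB: "closedin X A \<and> closedin X B \<and> ?S \<subseteq> A \<union> B"
      show "?S \<subseteq> A \<or> ?S \<subseteq> B"
      proof (rule ccontr)
        assume "\<not> (?S \<subseteq> A \<or> ?S \<subseteq> B)"
        then have "topspace X - A \<in> P" "topspace X - B \<in> P"
          using AB mem[of "topspace X - A"] mem[of "topspace X - B"] by (auto simp: closedin_def)
        then have "(topspace X - A) \<inter> (topspace X - B) \<in> P" by (rule int)
        moreover have "openin X ((topspace X - A) \<inter> (topspace X - B))" using AB by blast
        ultimately show False using mem AB by blast
      qed
    qed auto
    ultimately have "\<exists>x. x \<in> topspace X \<and> X closure_of {x} = ?S"
      using assms unfolding sober_space_def by (metis (no_types, lifting))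
    then obtain x where x: "x \<in> topspace X" "X closure_of {x} = ?S" by blast
    have "x \<in> U \<longleftrightarrow> U \<in> P" if U: "openin X U" for U
    proof -
      have "x \<in> U \<longleftrightarrow> U \<inter> X closure_of {x} \<noteq> {}"
        using openin_Int_closure_of_eq_empty[OF U, of "{x}"] by blast
      also have "\<dots> \<longleftrightarrow> U \<in> P" using x(2) mem[OF U] openin_subset[OF U] by blast
      finally show ?thesis .
    qed
    then have "eta X x = P" using PD(1) by (auto simp: eta_def mem_opens)
    then show ?thesis using x(1) by blast
  qed
  ultimately show ?thesis
    unfolding bij_betw_def using eta_in_cp_filters[of _ X] by (simp add: set_eq_iff) blast
qed

section \<open>Countable intersections of open sets in a sober space\<close>

lemma gdelta_inE:
  assumes "gdelta_in Y S"
  obtains A where "countable A" "A \<subseteq> opens Y" "S = topspace Y \<inter> \<Inter>A"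
proof -
  obtain A where "countable A" "A \<subseteq> Collect (openin Y)" "S = \<Inter>A" "S \<subseteq> topspace Y"
    using assms unfolding gdelta_in_alt intersection_of_def by blast
  then show ?thesis using that[of A] by (auto simp: subset_opens_iff)
qed

text \<open>\<open>h\<close> identifies \<open>X\<close> with the part \<open>S\<close> of
  \<open>Y\<close> cut out by \<open>A\<close>. Sobriety of \<open>Y\<close> is recorded in the form
  in which it is used: each point of the frame \<open>opens Y\<close> comes from exactly one point
  of \<open>Y\<close>.\<close>

locale gdelta_embedding =
  fixes X :: "'a topology" and Y :: "'b topology" and S A h
  assumes sober: "bij_betw (eta Y) (topspace Y) (cp_filters (opens Y) (\<subseteq>))"
    and A: "A \<subseteq> opens Y" "S = topspace Y \<inter> \<Inter>A"
    and h: "homeomorphic_map X (subtopology Y S) h"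
begin

lemma h_image: "h ` topspace X = S"
  and h_inj: "inj_on h (topspace X)"
  using h A(2) by (auto simp: homeomorphic_map_def quotient_map_def inf.absorb2)

lemma openin_pullback: "openin Y U \<Longrightarrow> openin X {x \<in> topspace X. h x \<in> U}"
proof -
  assume U: "openin Y U"
  have "{x \<in> topspace X. h x \<in> U} = {x \<in> topspace X. h x \<in> U \<inter> S}"
    using h_image by blast
  moreover have "openin (subtopology Y S) (U \<inter> S)" using U by (auto simp: openin_subtopology)
  ultimately show ?thesis
    using openin_continuous_map_preimage[OF homeomorphic_imp_continuous_map[OF h], of "U \<inter> S"] by simp
qed

lemma openin_pullbackE:
  assumes "openin X W"
  obtains U where "openin Y U" "W = {x \<in> topspace X. h x \<in> U}"
proof -
  have "openin (subtopology Y S) (h ` W)"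
    using homeomorphic_map_openness_eq[OF h] assms by blast
  then obtain U where U: "openin Y U" "h ` W = U \<inter> S" by (auto simp: openin_subtopology)
  have "W = {x \<in> topspace X. h x \<in> U}"
  proof (intro equalityI subsetI CollectI conjI)
    fix x assume "x \<in> {x \<in> topspace X. h x \<in> U}"
    then have x: "x \<in> topspace X" "h x \<in> h ` W" using U h_image by auto
    then show "x \<in> W"
      using h_inj openin_subset[OF assms] by (auto dest: inj_onD)
  qed (use U openin_subset[OF assms] in auto)
  then show ?thesis using that U by blast
qed

text \<open>A point of \<open>opens X\<close> is pushed forward along \<open>h\<close> to a point of
  \<open>opens Y\<close>, which belongs to some \<open>y\<close> by sobriety. Every \<open>a\<close>
  in \<open>A\<close> pulls back to all of \<open>X\<close>, so \<open>y\<close> lies in each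
  \<open>a\<close> and hence in \<open>S\<close>.\<close>

lemma eta_bij: "bij_betw (eta X) (topspace X) (cp_filters (opens X) (\<subseteq>))"
proof -
  interpret X: clat "opens X" "(\<subseteq>)" by (rule clat_opens)
  interpret Y: clat "opens Y" "(\<subseteq>)" by (rule clat_opens)
  have "inj_on (eta X) (topspace X)"
  proof (rule inj_onI)
    fix x y assume xy: "x \<in> topspace X" "y \<in> topspace X" "eta X x = eta X y"
    have "h x \<in> U \<longleftrightarrow> h y \<in> U" if "openin Y U" for U
    proof -
      have "{x \<in> topspace X. h x \<in> U} \<in> eta X x \<longleftrightarrow> {x \<in> topspace X. h x \<in> U} \<in> eta X y"
        using xy(3) by simp
      then show ?thesis using openin_pullback[OF that] xy(1,2) by (simp add: eta_def)
    qed
    then have "eta Y (h x) = eta Y (h y)" by (auto simp: eta_def)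
    moreover have "h x \<in> topspace Y" "h y \<in> topspace Y" using h_image xy A(2) by auto
    ultimately have "h x = h y" using sober by (auto simp: bij_betw_def dest: inj_onD)
    then show "x = y" using h_inj xy by (auto dest: inj_onD)
  qed
  moreover have "P \<in> eta X ` topspace X" if P: "P \<in> cp_filters (opens X) (\<subseteq>)" for P
  proof -
    note PD = X.cp_filtersD[OF P]
    let ?b = "\<lambda>U. {x \<in> topspace X. h x \<in> U}"
    let ?P = "{U. openin Y U \<and> ?b U \<in> P}"
    have b: "?b U \<in> opens X" if "openin Y U" for U
      using openin_pullback[OF that] by (simp add: mem_opens)
    have topP: "topspace X \<in> P"
      using PD(3)[of "{}"] linf_opens_finite[of "{}" X] by simp
    have in_top: "?b U = topspace X" if "S \<subseteq> U" for U using that h_image by blast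
    have "?P \<in> cp_filters (opens Y) (\<subseteq>)"
    proof (rule Y.cp_filtersI)
      show "?P \<subseteq> opens Y" by (auto simp: mem_opens)
      have "topspace Y \<in> ?P" using topP in_top[of "topspace Y"] A(2) by simp
      then show "?P \<noteq> {}" by blast
      show "V \<in> ?P" if UV: "U \<in> ?P" "V \<in> opens Y" "U \<subseteq> V" for U V
      proof -
        have "openin Y V" "?b U \<in> P" "?b U \<subseteq> ?b V" using UV by (auto simp: mem_opens)
        then show ?thesis using PD(2)[of "?b U" "?b V"] b by simp
      qed
      show "\<exists>W\<in>?P. W \<subseteq> U \<and> W \<subseteq> V" if UV: "U \<in> ?P" "V \<in> ?P" for U V
      proof -
        have "linf (opens X) (\<subseteq>) {?b U, ?b V} \<in> P" using PD(3)[of "{?b U, ?b V}"] UV by simp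
        moreover have "linf (opens X) (\<subseteq>) {?b U, ?b V} = ?b (U \<inter> V)"
          using linf_opens_finite[of "{?b U, ?b V}" X] b UV by auto
        ultimately show ?thesis using UV by (intro bexI[of _ "U \<inter> V"]) auto
      qed
      show "\<exists>U\<in>\<S>. U \<in> ?P" if \<S>: "\<S> \<subseteq> opens Y" "lsup (opens Y) (\<subseteq>) \<S> \<in> ?P" for \<S>
      proof -
        have sub: "?b ` \<S> \<subseteq> opens X" using \<S>(1) b by (auto simp: mem_opens)
        have "?b (\<Union>\<S>) \<in> P" using \<S> lsup_opens[OF \<S>(1)] by simp
        moreover have "?b (\<Union>\<S>) = lsup (opens X) (\<subseteq>) (?b ` \<S>)"
          unfolding lsup_opens[OF sub] by blast
        ultimately have "\<exists>W\<in>?b ` \<S>. W \<in> P" using PD(4)[OF sub] by simp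
        then show ?thesis using \<S>(1) by (auto simp: subset_opens_iff)
      qed
    qed
    then obtain y where y: "y \<in> topspace Y" "eta Y y = ?P"
      using sober unfolding bij_betw_def by (metis (no_types, lifting) imageE)
    have "y \<in> a" if a: "a \<in> A" for a
    proof -
      have "openin Y a" "?b a = topspace X" using a A in_top[of a] by (auto simp: mem_opens)
      then have "a \<in> ?P" using topP by simp
      then show ?thesis unfolding y(2)[symmetric] by (simp add: eta_def)
    qed
    then have "y \<in> S" using y(1) A(2) by blast
    then obtain x where x: "x \<in> topspace X" "h x = y" using h_image by blast
    have "W \<in> eta X x \<longleftrightarrow> W \<in> P" if W: "openin X W" for W
    proof -
      obtain U where U: "openin Y U" "W = ?b U" using openin_pullbackE[OF W] by blast
      have "W \<in> eta X x \<longleftrightarrow> U \<in> eta Y y" using U x W by (auto simp: eta_def)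
      then show ?thesis unfolding y(2) using U by simp
    qed
    then have "eta X x = P" using PD(1) by (auto simp: eta_def mem_opens)
    then show ?thesis using x(1) by blast
  qed
  ultimately show ?thesis
    unfolding bij_betw_def using eta_in_cp_filters[of _ X] by (simp add: set_eq_iff) blast
qed

text \<open>Points of \<open>S\<close> have neighbourhood filters containing \<open>A\<close>, so
  \<open>prec_A\<close> respects traces. Conversely \<open>prec_A_spatial\<close> separates
  \<open>U\<close> from \<open>V\<close> by a filter containing \<open>A\<close>, which sobriety
  realises as a point of \<open>S\<close>.\<close>

lemma prec_A_opens_iff:
  assumes cont: "continuous_lattice (opens Y) (\<subseteq>)" and "countable A"
    and UV: "openin Y U" "openin Y V"
  shows "prec_A (opens Y) (\<subseteq>) A U V \<longleftrightarrow> U \<inter> S \<subseteq> V \<inter> S"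
proof -
  interpret Y: clat "opens Y" "(\<subseteq>)" by (rule clat_opens)
  have UV': "U \<in> opens Y" "V \<in> opens Y" using UV by (auto simp: mem_opens)
  show ?thesis
  proof
    assume prec: "prec_A (opens Y) (\<subseteq>) A U V"
    show "U \<inter> S \<subseteq> V \<inter> S"
    proof
      fix y assume y: "y \<in> U \<inter> S"
      then have "eta Y y \<in> cp_filters (opens Y) (\<subseteq>)" "A \<subseteq> eta Y y" "U \<in> eta Y y"
        using A UV eta_in_cp_filters[of y Y] by (auto simp: eta_def mem_opens)
      then have "V \<in> eta Y y" using Y.prec_A_cp_filter prec by blast
      then show "y \<in> V \<inter> S" using y by (simp add: eta_def)
    qed
  next
    assume sub: "U \<inter> S \<subseteq> V \<inter> S"
    show "prec_A (opens Y) (\<subseteq>) A U V"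
    proof (rule ccontr)
      assume "\<not> prec_A (opens Y) (\<subseteq>) A U V"
      then obtain P where P: "P \<in> cp_filters (opens Y) (\<subseteq>)" "A \<subseteq> P" "U \<in> P" "V \<notin> P"
        using Y.prec_A_spatial[OF cont opens_distributive A(1) assms(2) UV'] by blast
      then obtain y where y: "y \<in> topspace Y" "P = eta Y y"
        using sober unfolding bij_betw_def by blast
      then have "y \<in> U \<inter> S" "y \<notin> V" using P UV A(2) by (auto simp: eta_def)
      then show False using sub by blast
    qed
  qed
qed

text \<open>Open sets of \<open>Y\<close> have equal traces on \<open>S\<close> exactly when they
  are equivalent, so the class of an extension \<open>g W\<close> of \<open>W\<close> is independent
  of the choice of \<open>g\<close>.\<close>

lemma opens_quotient_iso:
  assumes cont: "continuous_lattice (opens Y) (\<subseteq>)" and "countable A"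
  shows "\<exists>f. frame_iso (opens X) (\<subseteq>) (quot_carrier (opens Y) (prec_A (opens Y) (\<subseteq>) A))
    (quot_le (prec_A (opens Y) (\<subseteq>) A)) f"
proof -
  interpret Y: clat "opens Y" "(\<subseteq>)" by (rule clat_opens)
  interpret q: quotient "opens Y" "(\<subseteq>)" "prec_A (opens Y) (\<subseteq>) A"
    using Y.cong_preorder_prec_A[OF A(1)] by unfold_locales
  let ?b = "\<lambda>U. {x \<in> topspace X. h x \<in> U}"
  define g where "g W = (SOME U. openin Y U \<and> W = ?b U)" for W
  have g: "openin Y (g W)" "W = ?b (g W)" if "openin X W" for W
    using someI_ex[of "\<lambda>U. openin Y U \<and> W = ?b U"] openin_pullbackE[OF that]
    unfolding g_def by blast+
  have gO: "g W \<in> opens Y" if "W \<in> opens X" for W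
    using g that by (simp add: mem_opens)
  have b_iff: "?b U \<subseteq> ?b V \<longleftrightarrow> prec_A (opens Y) (\<subseteq>) A U V" if "openin Y U" "openin Y V" for U V
    unfolding prec_A_opens_iff[OF cont assms(2) that] using h_image by blast
  have le: "q.le_Q (q.cls (g W)) (q.cls (g W')) \<longleftrightarrow> W \<subseteq> W'" if W: "W \<in> opens X" "W' \<in> opens X" for W W'
  proof -
    have o: "openin X W" "openin X W'" using W by (simp_all add: mem_opens)
    have "q.le_Q (q.cls (g W)) (q.cls (g W')) \<longleftrightarrow> ?b (g W) \<subseteq> ?b (g W')"
      using q.quot_le_cls[OF gO gO] W b_iff[OF g(1) g(1)] o by simp
    then show ?thesis using g(2)[OF o(1)] g(2)[OF o(2)] by simp
  qed
  have "frame_iso (opens X) (\<subseteq>) q.Q q.le_Q (q.cls \<circ> g)"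
  proof (rule frame_isoI[OF clat_opens q.poset_quot])
    show "bij_betw (q.cls \<circ> g) (opens X) q.Q"
      unfolding bij_betw_def
    proof
      show "inj_on (q.cls \<circ> g) (opens X)"
      proof (rule inj_onI)
        fix W W' assume W: "W \<in> opens X" "W' \<in> opens X" "(q.cls \<circ> g) W = (q.cls \<circ> g) W'"
        then show "W = W'" using le[of W W'] le[of W' W] le[of W W] by simp
      qed
      show "(q.cls \<circ> g) ` opens X = q.Q"
      proof
        show "(q.cls \<circ> g) ` opens X \<subseteq> q.Q" using gO by (auto simp: q.quot_carrier_eq)
        show "q.Q \<subseteq> (q.cls \<circ> g) ` opens X"
        proof
          fix c assume "c \<in> q.Q"
          then obtain U where U: "U \<in> opens Y" "c = q.cls U" unfolding q.quot_carrier_eq by blast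
          have o: "openin Y U" "openin X (?b U)" using U openin_pullback by (auto simp: mem_opens)
          have "q.cls (g (?b U)) = q.cls U"
            using q.cls_eq_iff[of "g (?b U)" U] b_iff[OF g(1)[OF o(2)] o(1)] b_iff[OF o(1) g(1)[OF o(2)]]
              g[OF o(2)] U(1) by (simp add: mem_opens)
          then show "c \<in> (q.cls \<circ> g) ` opens X"
            using U o(2) by (intro image_eqI[of _ _ "?b U"]) (auto simp: mem_opens)
        qed
      qed
    qed
  qed (use le in simp)
  then show ?thesis by blast
qed

end

text \<open>Serves both kinds of spaces: locally compact sober spaces and continuous dcpos enter
  through sobriety and continuity of the lattice of open sets.\<close>

lemma gdelta_subspace_frame:
  assumes "sober_space Y" "gdelta_in Y S" "X homeomorphic_space subtopology Y S"
    and cont: "continuous_lattice (opens Y) (\<subseteq>)"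
  shows "homeomorphic_map X (pt_top (opens X) (\<subseteq>)) (eta X)"
    and "\<exists>A. A \<subseteq> opens Y \<and> countable A \<and> (\<exists>f. frame_iso (opens X) (\<subseteq>)
      (quot_carrier (opens Y) (prec_A (opens Y) (\<subseteq>) A)) (quot_le (prec_A (opens Y) (\<subseteq>) A)) f)"
proof -
  obtain A where A: "countable A" "A \<subseteq> opens Y" "S = topspace Y \<inter> \<Inter>A"
    using gdelta_inE[OF assms(2)] by blast
  obtain h where "homeomorphic_map X (subtopology Y S) h"
    using assms(3) homeomorphic_space by blast
  then interpret gdelta_embedding X Y S A h
    using A sober_eta_bij[OF assms(1)] by unfold_locales
  show "homeomorphic_map X (pt_top (opens X) (\<subseteq>)) (eta X)"
    by (rule homeomorphic_map_eta[OF eta_bij])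
  show "\<exists>A. A \<subseteq> opens Y \<and> countable A \<and> (\<exists>f. frame_iso (opens X) (\<subseteq>)
      (quot_carrier (opens Y) (prec_A (opens Y) (\<subseteq>) A)) (quot_le (prec_A (opens Y) (\<subseteq>) A)) f)"
    using opens_quotient_iso[OF cont] \<open>countable A\<close> \<open>A \<subseteq> opens Y\<close> by blast
qed

text \<open>A compact set between \<open>V\<close> and \<open>U\<close> makes \<open>V\<close> way
  below \<open>U\<close>, because one member of a directed cover of \<open>U\<close> already
  contains it. Local compactness provides such a \<open>V\<close> around each point of
  \<open>U\<close>.\<close>

lemma locally_compact_continuous_lattice:
  assumes "locally_compact_sat Y"
  shows "continuous_lattice (opens Y) (\<subseteq>)"
  unfolding continuous_lattice_def
proof (intro conjI ballI)
  interpret clat "opens Y" "(\<subseteq>)" by (rule clat_opens)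
  show "complete_lattice_on (opens Y) (\<subseteq>)" using clat_opens clat_iff by blast
  fix U assume U: "U \<in> opens Y"
  let ?W = "{V \<in> opens Y. way_below (opens Y) (\<subseteq>) V U}"
  have wb: "way_below (opens Y) (\<subseteq>) V U" if K: "compactin Y K" "V \<subseteq> K" "K \<subseteq> U" for V K
    unfolding way_below_def
  proof (intro allI impI)
    fix D s assume D: "directed_on (opens Y) (\<subseteq>) D \<and> is_lub (opens Y) (\<subseteq>) D s \<and> U \<subseteq> s"
    then have DO: "D \<subseteq> opens Y" by (simp add: directed_on_def)
    then have "s = \<Union>D" using D lsup_eq lsup_opens by metis
    then have "K \<subseteq> \<Union>D" using K D by blast
    moreover have "\<And>d. d \<in> D \<Longrightarrow> openin Y d" using DO by (auto simp: subset_opens_iff)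
    ultimately obtain \<F> where F: "finite \<F>" "\<F> \<subseteq> D" "K \<subseteq> \<Union>\<F>"
      using K(1) unfolding compactin_def by meson
    have "\<exists>d\<in>D. \<forall>v\<in>\<F>. v \<subseteq> d"
      by (rule directed_finite_bound) (use D F DO in auto)
    then show "\<exists>d\<in>D. V \<subseteq> d" using K(2) F(3) by blast
  qed
  have "\<Union>?W = U"
  proof
    show "\<Union>?W \<subseteq> U" using way_below_imp_le U by blast
    show "U \<subseteq> \<Union>?W"
    proof
      fix x assume x: "x \<in> U"
      then have "x \<in> topspace Y" "openin Y U" using U openin_subset by (auto simp: mem_opens)
      then obtain V K where "openin Y V" "compactin Y K" "x \<in> V" "V \<subseteq> K" "K \<subseteq> U"
        using assms x unfolding locally_compact_sat_def by meson
      then show "x \<in> \<Union>?W" using wb by (auto simp: mem_opens)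
    qed
  qed
  then show "is_lub (opens Y) (\<subseteq>) ?W U" using opens_is_lub[of ?W Y] by auto
qed

subsection \<open>Continuous dcpos\<close>

text \<open>Unfolding \<open>topology\<close> requires \<open>istopology\<close>. Binary
  intersections are the case that uses directedness: an upper bound of a member in \<open>U\<close>
  and a member in \<open>V\<close> lies in both.\<close>

lemma openin_scott_topology:
  "openin (scott_topology C le) U \<longleftrightarrow> U \<subseteq> C \<and> (\<forall>x\<in>U. \<forall>y\<in>C. le x y \<longrightarrow> y \<in> U) \<and>
     (\<forall>D s. directed_on C le D \<and> is_lub C le D s \<and> s \<in> U \<longrightarrow> D \<inter> U \<noteq> {})"
    (is "_ \<longleftrightarrow> ?P U")
proof -
  have "istopology ?P"
    unfolding istopology_def
  proof (intro conjI allI impI)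
    fix U V assume UV: "?P U" "?P V"
    show "U \<inter> V \<subseteq> C" using UV by blast
    show "\<forall>x\<in>U \<inter> V. \<forall>y\<in>C. le x y \<longrightarrow> y \<in> U \<inter> V" using UV by blast
    fix D s assume D: "directed_on C le D \<and> is_lub C le D s \<and> s \<in> U \<inter> V"
    then have "D \<inter> U \<noteq> {}" "D \<inter> V \<noteq> {}" using UV by blast+
    then obtain d e where de: "d \<in> D" "d \<in> U" "e \<in> D" "e \<in> V" by blast
    then obtain z where "z \<in> D" "le d z" "le e z" "z \<in> C"
      using D unfolding directed_on_def by (meson subsetD)
    then show "D \<inter> (U \<inter> V) \<noteq> {}" using de UV by blast
  next
    fix \<K> assume K: "\<forall>U\<in>\<K>. ?P U"
    show "\<Union>\<K> \<subseteq> C" using K by blast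
    show "\<forall>x\<in>\<Union>\<K>. \<forall>y\<in>C. le x y \<longrightarrow> y \<in> \<Union>\<K>" using K by blast
    fix D s assume D: "directed_on C le D \<and> is_lub C le D s \<and> s \<in> \<Union>\<K>"
    then obtain U where U: "U \<in> \<K>" "s \<in> U" by blast
    then have "D \<inter> U \<noteq> {}" using K D by blast
    then show "D \<inter> \<Union>\<K> \<noteq> {}" using U by blast
  qed
  then show ?thesis unfolding scott_topology_def by (simp add: topology_inverse')
qed

lemma openin_scott_topologyD:
  assumes "openin (scott_topology C le) U"
  shows "U \<subseteq> C" "\<And>x y. x \<in> U \<Longrightarrow> y \<in> C \<Longrightarrow> le x y \<Longrightarrow> y \<in> U"
    "\<And>D s. directed_on C le D \<Longrightarrow> is_lub C le D s \<Longrightarrow> s \<in> U \<Longrightarrow> \<exists>d\<in>D. d \<in> U"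
proof -
  note * = assms[unfolded openin_scott_topology disjoint_iff]
  show "U \<subseteq> C" using * by (rule conjunct1)
  show "y \<in> U" if "x \<in> U" "y \<in> C" "le x y" for x y
    using *[THEN conjunct2, THEN conjunct1] that by simp
  show "\<exists>d\<in>D. d \<in> U" if "directed_on C le D" "is_lub C le D s" "s \<in> U" for D s
    using *[THEN conjunct2, THEN conjunct2, rule_format, of D s] that by blast
qed

lemma openin_scott_topologyI:
  assumes "U \<subseteq> C" "\<And>x y. x \<in> U \<Longrightarrow> y \<in> C \<Longrightarrow> le x y \<Longrightarrow> y \<in> U"
    "\<And>D s. directed_on C le D \<Longrightarrow> is_lub C le D s \<Longrightarrow> s \<in> U \<Longrightarrow> \<exists>d\<in>D. d \<in> U"
  shows "openin (scott_topology C le) U"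
  unfolding openin_scott_topology disjoint_iff
proof (intro conjI ballI allI impI)
  show "\<not> (\<forall>x. x \<in> D \<longrightarrow> x \<notin> U)" if "directed_on C le D \<and> is_lub C le D s \<and> s \<in> U" for D s
    using assms(3)[of D s] that by blast
qed (use assms(1,2) in simp_all)

lemma topspace_scott_topology: "topspace (scott_topology C le) = C"
proof
  show "topspace (scott_topology C le) \<subseteq> C"
    by (rule openin_scott_topologyD(1)) (rule openin_topspace)
  have "openin (scott_topology C le) C"
    by (rule openin_scott_topologyI) (auto simp: directed_on_def)
  then show "C \<subseteq> topspace (scott_topology C le)" by (rule openin_subset)
qed

context cont_dcpo
begin

abbreviation "upper x \<equiv> {y\<in>C. way_below C le x y}"

text \<open>An interpolant \<open>z\<close> between \<open>x\<close> and the supremum lies below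
  some member of the directed set, and that member is then way above \<open>x\<close>.\<close>

lemma openin_upper:
  assumes "x \<in> C"
  shows "openin (scott_topology C le) (upper x)"
proof (rule openin_scott_topologyI)
  show "z \<in> upper x" if "y \<in> upper x" "z \<in> C" "y \<sqsubseteq> z" for y z
    using way_below_mono[OF _ refl that(3)] that assms by blast
  fix D s assume D: "directed_on C le D" "is_lub C le D s" "s \<in> upper x"
  then obtain z where z: "z \<in> C" "way_below C le x z" "way_below C le z s"
    using way_below_interpolation assms by blast
  then obtain d where d: "d \<in> D" "z \<sqsubseteq> d" using D refl unfolding way_below_def[of C le z] by blast
  moreover have "d \<in> C" using D(1) d by (auto simp: directed_on_def)
  ultimately show "\<exists>d\<in>D. d \<in> upper x" using way_below_mono[OF z(2) refl] assms z(1) by blast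
qed auto

lemma open_way_below:
  assumes "openin (scott_topology C le) U" "y \<in> U"
  shows "\<exists>x\<in>U. x \<in> C \<and> way_below C le x y"
proof -
  have "y \<in> C" using openin_scott_topologyD(1)[OF assms(1)] assms(2) by blast
  then show ?thesis
    using openin_scott_topologyD(3)[OF assms(1) way_below_directed way_below_lub] assms(2) by blast
qed

lemma upper_subset:
  assumes "openin (scott_topology C le) U" "x \<in> U"
  shows "upper x \<subseteq> U"
  using openin_scott_topologyD(2)[OF assms] way_below_imp_le by blast

text \<open>The generic point is the supremum of \<open>?I\<close>. Irreducibility, applied to the
  complements of \<open>upper a\<close> and \<open>upper b\<close>, yields one member of
  \<open>S\<close> way above both, so \<open>?I\<close> is directed; \<open>S\<close> is closed
  under directed suprema, and each of its members is a supremum of elements of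
  \<open>?I\<close>.\<close>

lemma scott_sober: "sober_space (scott_topology C le)"
  unfolding sober_space_def
proof (intro allI impI)
  let ?X = "scott_topology C le"
  fix S assume S: "closedin ?X S \<and> irreducible_in ?X S"
  then have irr: "\<And>A B. closedin ?X A \<Longrightarrow> closedin ?X B \<Longrightarrow> S \<subseteq> A \<union> B \<Longrightarrow> S \<subseteq> A \<or> S \<subseteq> B"
    unfolding irreducible_in_def by simp
  have S0: "S \<noteq> {}" "S \<subseteq> C" and op: "openin ?X (C - S)"
    using S by (auto simp: irreducible_in_def closedin_def topspace_scott_topology)
  have down: "x \<in> S" if "y \<in> S" "x \<in> C" "x \<sqsubseteq> y" for x y
    using openin_scott_topologyD(2)[OF op, of x y] that S0 by blast
  let ?I = "{x\<in>C. \<exists>y\<in>S. way_below C le x y}"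
  have IS: "?I \<subseteq> S" using down way_below_imp_le S0 by blast
  have dir: "directed_on C le ?I"
    unfolding directed_on_def
  proof (intro conjI ballI)
    obtain y where "y \<in> S" "y \<in> C" using S0 by blast
    then show "?I \<noteq> {}" using way_below_directed[of y] by (auto simp: directed_on_def)
    fix a b assume ab: "a \<in> ?I" "b \<in> ?I"
    have cl: "closedin ?X (C - upper x)" if "x \<in> C" for x
      using openin_closedin_eq[of ?X "upper x"] openin_upper[OF that] by (simp add: topspace_scott_topology)
    have "\<not> S \<subseteq> C - upper a" "\<not> S \<subseteq> C - upper b" using ab S0(2) by blast+
    then have "\<not> S \<subseteq> (C - upper a) \<union> (C - upper b)" using irr cl ab by blast
    then obtain y where y: "y \<in> S" "y \<in> C" "way_below C le a y" "way_below C le b y" using S0(2) by blast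
    then obtain z where "z \<in> C" "way_below C le z y" "a \<sqsubseteq> z" "b \<sqsubseteq> z"
      using way_below_directed[OF y(2)] ab unfolding directed_on_def by blast
    then show "\<exists>z\<in>?I. a \<sqsubseteq> z \<and> b \<sqsubseteq> z" using y by blast
  qed auto
  obtain s where s: "is_lub C le ?I s" using directed_lub[OF dir] by blast
  then have sC: "s \<in> C" by (simp add: is_lub_def)
  have sS: "s \<in> S" using openin_scott_topologyD(3)[OF op dir s] sC IS by blast
  have above: "y \<sqsubseteq> s" if y: "y \<in> S" for y
  proof -
    have yC: "y \<in> C" using y S0 by blast
    have "\<forall>x\<in>{x\<in>C. way_below C le x y}. x \<sqsubseteq> s"
      using s y unfolding is_lub_def by blast
    then show ?thesis using way_below_lub[OF yC] sC unfolding is_lub_def by blast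
  qed
  have cl: "?X closure_of {x} = {y\<in>C. y \<sqsubseteq> x}" if x: "x \<in> C" for x
  proof
    have "openin ?X (C - {y\<in>C. y \<sqsubseteq> x})"
    proof (rule openin_scott_topologyI)
      fix D t assume D: "directed_on C le D" "is_lub C le D t" "t \<in> C - {y \<in> C. y \<sqsubseteq> x}"
      then show "\<exists>d\<in>D. d \<in> C - {y \<in> C. y \<sqsubseteq> x}"
        using x unfolding is_lub_def directed_on_def by blast
    next
      fix y z assume "y \<in> C - {y \<in> C. y \<sqsubseteq> x}" "z \<in> C" "y \<sqsubseteq> z"
      then show "z \<in> C - {y \<in> C. y \<sqsubseteq> x}" using trans[of y z x] x by blast
    qed auto
    then have "closedin ?X {y\<in>C. y \<sqsubseteq> x}" by (auto simp: closedin_def topspace_scott_topology)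
    then show "?X closure_of {x} \<subseteq> {y\<in>C. y \<sqsubseteq> x}"
      by (rule closure_of_minimal[rotated]) (use x refl in simp)
    show "{y\<in>C. y \<sqsubseteq> x} \<subseteq> ?X closure_of {x}"
      using openin_scott_topologyD(2) x by (auto simp: in_closure_of topspace_scott_topology)
  qed
  show "\<exists>!x. x \<in> topspace ?X \<and> ?X closure_of {x} = S"
  proof
    show "s \<in> topspace ?X \<and> ?X closure_of {s} = S"
      using cl[OF sC] sC above down[OF sS] S0 by (auto simp: topspace_scott_topology)
    fix x assume "x \<in> topspace ?X \<and> ?X closure_of {x} = S"
    then have x: "x \<in> C" "S = {y\<in>C. y \<sqsubseteq> x}" using cl by (auto simp: topspace_scott_topology)
    then have "x \<sqsubseteq> s" "s \<sqsubseteq> x" using above sS refl by auto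
    then show "x = s" using antisym x sC by blast
  qed
qed

text \<open>For \<open>x \<in> U\<close> the set \<open>upper x\<close> is way below
  \<open>U\<close>: a directed cover of \<open>U\<close> has a member containing \<open>x\<close>,
  and this member is an upper set.\<close>

lemma scott_opens_continuous: "continuous_lattice (opens (scott_topology C le)) (\<subseteq>)"
  unfolding continuous_lattice_def
proof (intro conjI ballI)
  let ?X = "scott_topology C le"
  interpret O: clat "opens ?X" "(\<subseteq>)" by (rule clat_opens)
  show "complete_lattice_on (opens ?X) (\<subseteq>)" using clat_opens clat_iff by blast
  fix U assume U: "U \<in> opens ?X"
  let ?W = "{V \<in> opens ?X. way_below (opens ?X) (\<subseteq>) V U}"
  have wb: "way_below (opens ?X) (\<subseteq>) (upper x) U" if xU: "x \<in> U" for x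
    unfolding way_below_def[of "opens ?X"]
  proof (intro allI impI)
    fix D s assume D: "directed_on (opens ?X) (\<subseteq>) D \<and> is_lub (opens ?X) (\<subseteq>) D s \<and> U \<subseteq> s"
    then have DO: "D \<subseteq> opens ?X" by (simp add: directed_on_def)
    then have "s = \<Union>D" using D O.lsup_eq lsup_opens by metis
    then obtain d where "d \<in> D" "x \<in> d" using D xU by blast
    moreover from this have "upper x \<subseteq> d" using DO by (intro upper_subset) (auto simp: subset_opens_iff)
    ultimately show "\<exists>d\<in>D. upper x \<subseteq> d" by blast
  qed
  have "\<Union>?W = U"
  proof
    show "\<Union>?W \<subseteq> U" using O.way_below_imp_le U by blast
    show "U \<subseteq> \<Union>?W"
    proof
      fix y assume y: "y \<in> U"
      have o: "openin ?X U" using U by (simp add: mem_opens)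
      obtain x where x: "x \<in> U" "x \<in> C" "way_below C le x y" using open_way_below[OF o y] by blast
      have "upper x \<in> ?W" using wb[OF x(1)] openin_upper[OF x(2)] by (simp add: mem_opens)
      moreover have "y \<in> upper x" using x y openin_scott_topologyD(1)[OF o] by blast
      ultimately show "y \<in> \<Union>?W" by blast
    qed
  qed
  then show "is_lub (opens ?X) (\<subseteq>) ?W U" using opens_is_lub[of ?W ?X] by auto
qed

text \<open>Some \<open>x\<close> way below \<open>y\<close> lies in the same open set and hence in
  a chosen member \<open>f S\<close> of every \<open>S\<close>. The open set \<open>upper x\<close>
  lies inside all these choices at once, so \<open>y\<close> belongs to their infimum and not merely
  to their intersection.\<close>

lemma scott_opens_completely_distributive:
  "completely_distributive_on (opens (scott_topology C le)) (\<subseteq>)"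
  unfolding completely_distributive_on_def
proof (intro allI impI)
  let ?X = "scott_topology C le"
  interpret O: clat "opens ?X" "(\<subseteq>)" by (rule clat_opens)
  fix \<S> assume \<S>: "\<S> \<subseteq> Pow (opens ?X)"
  let ?sup = "lsup (opens ?X) (\<subseteq>)" and ?inf = "linf (opens ?X) (\<subseteq>)"
  let ?G = "{?inf (f ` \<S>) |f. \<forall>S\<in>\<S>. f S \<in> S}"
  have sup: "?sup S = \<Union>S" if "S \<in> \<S>" for S using lsup_opens that \<S> by blast
  have supO: "?sup ` \<S> \<subseteq> opens ?X" using O.lsup_closed \<S> by blast
  have fO: "f ` \<S> \<subseteq> opens ?X" if "\<forall>S\<in>\<S>. f S \<in> S" for f using that \<S> by blast
  have GO: "?G \<subseteq> opens ?X" using O.linf_closed fO by blast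
  show "?inf (?sup ` \<S>) = ?sup ?G"
  proof
    show "?sup ?G \<subseteq> ?inf (?sup ` \<S>)"
    proof (rule O.lsup_least[OF GO O.linf_closed[OF supO]])
      fix g assume "g \<in> ?G"
      then obtain f where f: "\<forall>S\<in>\<S>. f S \<in> S" "g = ?inf (f ` \<S>)" by blast
      show "g \<subseteq> ?inf (?sup ` \<S>)"
      proof (rule O.linf_greatest[OF supO])
        show "g \<in> opens ?X" using f O.linf_closed fO by blast
        fix s assume "s \<in> ?sup ` \<S>"
        then obtain S where S: "S \<in> \<S>" "s = ?sup S" by blast
        have "g \<subseteq> f S" using f O.linf_lower[OF fO] S by blast
        then show "g \<subseteq> s" using f S sup by blast
      qed
    qed
    show "?inf (?sup ` \<S>) \<subseteq> ?sup ?G"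
    proof
      fix y assume y: "y \<in> ?inf (?sup ` \<S>)"
      have o: "openin ?X (?inf (?sup ` \<S>))" using O.linf_closed[OF supO] by (simp add: mem_opens)
      obtain x where x: "x \<in> ?inf (?sup ` \<S>)" "x \<in> C" "way_below C le x y"
        using open_way_below[OF o y] by blast
      have "\<exists>U\<in>S. x \<in> U" if S: "S \<in> \<S>" for S
        using O.linf_lower[OF supO, of "?sup S"] x(1) S sup[OF S] by blast
      then obtain f where f: "\<forall>S\<in>\<S>. f S \<in> S \<and> x \<in> f S" by metis
      have "upper x \<subseteq> ?inf (f ` \<S>)"
      proof (rule O.linf_greatest)
        show "f ` \<S> \<subseteq> opens ?X" using fO f by blast
        show "upper x \<in> opens ?X" using openin_upper x by (simp add: mem_opens)
        show "upper x \<subseteq> s" if "s \<in> f ` \<S>" for s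
        proof (rule upper_subset)
          show "openin ?X s" using that f \<S> by (auto simp: subset_opens_iff)
          show "x \<in> s" using that f by blast
        qed
      qed
      moreover have "y \<in> upper x" using x y openin_scott_topologyD(1)[OF o] by blast
      moreover have "?inf (f ` \<S>) \<subseteq> ?sup ?G" by (rule O.lsup_upper[OF GO]) (use f in blast)
      ultimately show "y \<in> ?sup ?G" by blast
    qed
  qed
qed

end

lemma cont_dcpo_iff: "cont_dcpo C le \<longleftrightarrow> continuous_dcpo C le"
  unfolding cont_dcpo_def cont_dcpo_axioms_def poset_def continuous_dcpo_def dcpo_on_def by blast

subsection \<open>Completely distributive lattices\<close>

locale cd_lattice = clat +
  assumes cd: "completely_distributive_on C le"
begin

lemma distributive: "distributive_on C le"
  unfolding distributive_on_def
proof (intro ballI)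
  fix a b c assume abc: "a \<in> C" "b \<in> C" "c \<in> C"
  let ?\<S> = "{{a}, {b, c}}"
  have sing: "lsup C le {a} = a" using abc refl by (intro lsup_eq) (auto simp: is_lub_def)
  have "{linf C le (f ` ?\<S>) |f. \<forall>S\<in>?\<S>. f S \<in> S} = {linf C le {a, b}, linf C le {a, c}}" (is "?L = ?R")
  proof
    show "?L \<subseteq> ?R" by auto
    \<comment> \<open>If \<open>{b, c}\<close> equals \<open>{a}\<close>, then \<open>x\<close> is
      \<open>a\<close>, so the function below is a valid choice in the degenerate case too.\<close>
    have "linf C le {a, x} \<in> ?L" if "x \<in> {b, c}" for x
      using that by (intro CollectI exI[of _ "\<lambda>S. if S = {a} then a else x"]) auto
    then show "?R \<subseteq> ?L" by blast
  qed
  moreover have "linf C le (lsup C le ` ?\<S>) = lsup C le {linf C le (f ` ?\<S>) |f. \<forall>S\<in>?\<S>. f S \<in> S}"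
    using cd[unfolded completely_distributive_on_def, rule_format, of ?\<S>] abc by simp
  ultimately show "linf C le {a, lsup C le {b, c}} = lsup C le {linf C le {a, b}, linf C le {a, c}}"
    by (simp add: sing)
qed

text \<open>Raney's relation: way-below with arbitrary sets in place of directed ones. With
  \<open>S = {}\<close> it says that nothing is totally below the bottom.\<close>

definition totally_below :: "'a \<Rightarrow> 'a \<Rightarrow> bool" where
  "totally_below x y \<longleftrightarrow> (\<forall>S\<subseteq>C. y \<sqsubseteq> lsup C le S \<longrightarrow> (\<exists>s\<in>S. x \<sqsubseteq> s))"

lemma totally_below_mono:
  assumes "totally_below x y" "x' \<sqsubseteq> x" "x' \<in> C" "x \<in> C"
  shows "totally_below x' y"
  unfolding totally_below_def
proof (intro allI impI)
  fix S assume "S \<subseteq> C" "y \<sqsubseteq> lsup C le S"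
  then obtain s where "s \<in> S" "x \<sqsubseteq> s" using assms(1) unfolding totally_below_def by blast
  then show "\<exists>s\<in>S. x' \<sqsubseteq> s" using trans assms \<open>S \<subseteq> C\<close> by blast
qed

lemma totally_below_imp_le:
  assumes "totally_below x y" "y \<in> C"
  shows "x \<sqsubseteq> y"
proof -
  have "y \<sqsubseteq> lsup C le {y}" using lsup_upper[of "{y}" y] assms(2) by simp
  then show ?thesis using assms unfolding totally_below_def by blast
qed

text \<open>Raney's argument applies the distributive law to the family of all sets whose join is
  above \<open>y\<close>. The meet of a choice from this family is below a member of each such set,
  hence totally below \<open>y\<close>, and the law makes the join of these meets lie above
  \<open>y\<close>.\<close>

lemma lsup_totally_below:
  assumes y: "y \<in> C"
  shows "lsup C le {x\<in>C. totally_below x y} = y"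
proof -
  let ?T = "{x\<in>C. totally_below x y}"
  let ?\<S> = "{S. S \<subseteq> C \<and> y \<sqsubseteq> lsup C le S}"
  have T: "?T \<subseteq> C" by blast
  let ?G = "{linf C le (f ` ?\<S>) |f. \<forall>S\<in>?\<S>. f S \<in> S}"
  have "?G \<subseteq> ?T"
  proof
    fix g assume "g \<in> ?G"
    then obtain f where f: "\<forall>S\<in>?\<S>. f S \<in> S" "g = linf C le (f ` ?\<S>)" by blast
    have fC: "f ` ?\<S> \<subseteq> C" using f(1) by blast
    have "g \<sqsubseteq> f S" if "S \<in> ?\<S>" for S using f(2) linf_lower[OF fC] that by blast
    then have "totally_below g y" unfolding totally_below_def using f(1) by blast
    then show "g \<in> ?T" using linf_closed[OF fC] f(2) by simp
  qed
  then have G_le: "lsup C le ?G \<sqsubseteq> lsup C le ?T" using lsup_mono T by blast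
  have supC: "lsup C le ` ?\<S> \<subseteq> C" using lsup_closed by blast
  have "y \<sqsubseteq> linf C le (lsup C le ` ?\<S>)" using linf_greatest[OF supC y] by blast
  also have "linf C le (lsup C le ` ?\<S>) = lsup C le ?G"
    using cd[unfolded completely_distributive_on_def, rule_format, of ?\<S>] by blast
  finally have "y \<sqsubseteq> lsup C le ?G" .
  then have "y \<sqsubseteq> lsup C le ?T"
    using trans[OF _ G_le] y lsup_closed[OF T] lsup_closed \<open>?G \<subseteq> ?T\<close> T by blast
  moreover have "lsup C le ?T \<sqsubseteq> y"
    using lsup_least[OF T y] totally_below_imp_le y by blast
  ultimately show ?thesis using antisym lsup_closed[OF T] y by blast
qed

text \<open>Each \<open>z\<close> totally below \<open>y\<close> is a join of elements totally below
  \<open>z\<close>, so the elements two steps under \<open>y\<close> still have a join above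
  \<open>y\<close>, and \<open>x\<close> lies under one of them.\<close>

lemma totally_below_interpolation:
  assumes "totally_below x y" "x \<in> C" "y \<in> C"
  shows "\<exists>z\<in>C. totally_below x z \<and> totally_below z y"
proof -
  let ?T = "{w\<in>C. \<exists>z\<in>C. totally_below w z \<and> totally_below z y}"
  have T: "?T \<subseteq> C" by blast
  have "z \<sqsubseteq> lsup C le ?T" if z: "z \<in> C" "totally_below z y" for z
  proof -
    have "lsup C le {x\<in>C. totally_below x z} \<sqsubseteq> lsup C le ?T"
      using z by (intro lsup_mono T) blast
    then show ?thesis using lsup_totally_below[OF z(1)] by simp
  qed
  then have "lsup C le {x\<in>C. totally_below x y} \<sqsubseteq> lsup C le ?T"
    using lsup_closed[OF T] by (intro lsup_least) auto
  then have "y \<sqsubseteq> lsup C le ?T" using lsup_totally_below[OF assms(3)] by simp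
  then obtain w where w: "w \<in> ?T" "x \<sqsubseteq> w" using assms(1)[unfolded totally_below_def, rule_format, OF T] by blast
  then obtain z where "z \<in> C" "totally_below w z" "totally_below z y" by blast
  then show ?thesis using totally_below_mono w assms(2) by blast
qed

text \<open>Points are approximated by points generated by chains descending along the totally-below
  relation; such a point has a lower bound in the point it approximates.\<close>

lemma approximating_point:
  assumes P: "P \<in> cp_filters C le" and u: "u \<in> P"
  shows "\<exists>x\<in>P. \<exists>Q\<in>cp_filters C le. u \<in> Q \<and> (\<forall>q\<in>Q. x \<sqsubseteq> q)"
proof -
  have uC: "u \<in> C" using cp_filtersD(1)[OF P] u by blast
  obtain x where x: "x \<in> C" "x \<in> P" "totally_below x u"
    using cp_filtersD(4)[OF P, of "{x\<in>C. totally_below x u}"] lsup_totally_below[OF uC] u by auto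
  have "\<exists>f. \<forall>n. ((f n \<in> C \<and> totally_below x (f n)) \<and> (n = 0 \<longrightarrow> f n = u)) \<and> totally_below (f (Suc n)) (f n)"
  proof (rule dependent_nat_choice)
    show "\<exists>y. (y \<in> C \<and> totally_below x y) \<and> ((0::nat) = 0 \<longrightarrow> y = u)" using uC x by blast
    fix y and n :: nat assume "(y \<in> C \<and> totally_below x y) \<and> (n = 0 \<longrightarrow> y = u)"
    then show "\<exists>z. ((z \<in> C \<and> totally_below x z) \<and> (Suc n = 0 \<longrightarrow> z = u)) \<and> totally_below z y"
      using totally_below_interpolation[of x y] x(1) by blast
  qed
  then obtain f where f: "\<And>n. f n \<in> C" "\<And>n. totally_below x (f n)" "f 0 = u"
    "\<And>n. totally_below (f (Suc n)) (f n)" by blast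
  let ?Q = "{y\<in>C. \<exists>n. f n \<sqsubseteq> y}"
  have desc: "f (Suc n) \<sqsubseteq> f n" for n using totally_below_imp_le f by blast
  note Q = chain_up_closure_filter[of f, OF f(1) desc]
  have uQ: "u \<in> ?Q" using Q(2)[of 0] f(3) by simp
  have "?Q \<in> cp_filters C le"
  proof (rule cp_filtersI)
    show "?Q \<noteq> {}" using uQ by blast
    fix S assume S: "S \<subseteq> C" "lsup C le S \<in> ?Q"
    then obtain n where "f n \<sqsubseteq> lsup C le S" by blast
    then obtain s where "s \<in> S" "f (Suc n) \<sqsubseteq> s"
      using f(4)[of n] S unfolding totally_below_def by blast
    then show "\<exists>s\<in>S. s \<in> ?Q" using S by blast
  qed (fact Q(1) | fact Q(3) | fact Q(4))+
  moreover have "x \<sqsubseteq> q" if q: "q \<in> ?Q" for q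
  proof -
    obtain n where "f n \<sqsubseteq> q" "q \<in> C" using q by blast
    then show ?thesis using trans[of x "f n" q] totally_below_imp_le f(1,2) x(1) by blast
  qed
  ultimately show ?thesis
    using uQ by (intro bexI[OF _ x(2)] bexI[of _ ?Q] conjI ballI)
qed

section \<open>The points of a completely distributive lattice as a continuous dcpo\<close>

abbreviation "pts \<equiv> cp_filters C le"

text \<open>The condition on joins concerns one member of \<open>D\<close> at a time; meets need two
  elements in a common member, which directedness supplies.\<close>

lemma directed_Union_cp_filter:
  assumes D: "directed_on pts (\<subseteq>) D"
  shows "\<Union>D \<in> pts"
proof (rule cp_filtersI)
  have DP: "D \<subseteq> pts" using D by (simp add: directed_on_def)
  then show "\<Union>D \<subseteq> C" using cp_filtersD(1) by blast
  obtain d where "d \<in> D" using D by (auto simp: directed_on_def)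
  then show "\<Union>D \<noteq> {}" using DP lsup_carrier_in_cp_filter by blast
  show "y \<in> \<Union>D" if xy: "x \<in> \<Union>D" "y \<in> C" "x \<sqsubseteq> y" for x y
  proof -
    obtain d where d: "d \<in> D" "x \<in> d" using xy(1) by blast
    then show ?thesis using cp_filtersD(2)[of d x y] DP xy by blast
  qed
  show "\<exists>z\<in>\<Union>D. z \<sqsubseteq> x \<and> z \<sqsubseteq> y" if xy: "x \<in> \<Union>D" "y \<in> \<Union>D" for x y
  proof -
    obtain d where d: "d \<in> D" "{x, y} \<subseteq> d" using xy D unfolding directed_on_def by blast
    then have "d \<in> pts" using DP by blast
    then have "linf C le {x, y} \<in> d" "{x, y} \<subseteq> C"
      using cp_filtersD(1,3)[of d] d by auto
    then show ?thesis using d linf_lower[of "{x, y}"] by blast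
  qed
  show "\<exists>s\<in>S. s \<in> \<Union>D" if S: "S \<subseteq> C" "lsup C le S \<in> \<Union>D" for S
  proof -
    obtain d where d: "d \<in> D" "lsup C le S \<in> d" using S(2) by blast
    then show ?thesis using cp_filtersD(4)[of d S] DP S by blast
  qed
qed

lemma directed_pts_lub:
  assumes "directed_on pts (\<subseteq>) D"
  shows "is_lub pts (\<subseteq>) D s \<longleftrightarrow> s = \<Union>D"
  using directed_Union_cp_filter[OF assms] by (auto simp: is_lub_def)

text \<open>If \<open>x\<close> bounds \<open>Q\<close> below, every point in the basic open set of
  \<open>x\<close> contains \<open>Q\<close>. This explicit condition stands in for the way-below
  relation, among whose points these turn out to be cofinal.\<close>

definition approximants :: "'a set \<Rightarrow> 'a set set" where
  "approximants P = {Q \<in> pts. \<exists>x\<in>P. \<forall>q\<in>Q. x \<sqsubseteq> q}"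

lemma approximants_subset:
  assumes "P \<in> pts" "Q \<in> approximants P"
  shows "Q \<subseteq> P"
  using assms cp_filtersD(1)[of Q] cp_filtersD(2)[OF assms(1)] unfolding approximants_def by blast

lemma approximants_Union:
  assumes "P \<in> pts"
  shows "\<Union>(approximants P) = P"
  using approximating_point[OF assms] approximants_subset[OF assms]
  unfolding approximants_def by blast

text \<open>The meet of the two lower bounds lies in \<open>P\<close> and hence in some approximant
  \<open>R\<close>; as an upper set, \<open>R\<close> then contains both \<open>Q\<close> and
  \<open>Q'\<close>.\<close>

lemma approximants_directed:
  assumes P: "P \<in> pts"
  shows "directed_on pts (\<subseteq>) (approximants P)"
  unfolding directed_on_def
proof (intro conjI ballI)
  show "approximants P \<noteq> {}"
    using approximants_Union[OF P] lsup_carrier_in_cp_filter[OF P] by blast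
  show "approximants P \<subseteq> pts" by (auto simp: approximants_def)
  fix Q Q' assume Q: "Q \<in> approximants P" "Q' \<in> approximants P"
  then obtain x x' where x: "x \<in> P" "\<forall>q\<in>Q. x \<sqsubseteq> q" "x' \<in> P" "\<forall>q\<in>Q'. x' \<sqsubseteq> q"
    unfolding approximants_def by blast
  have c: "{x, x'} \<subseteq> C" and QC: "Q \<subseteq> C" "Q' \<subseteq> C"
    using x P Q cp_filtersD(1) by (auto simp: approximants_def)
  have "linf C le {x, x'} \<in> P" using cp_filtersD(3)[OF P, of "{x, x'}"] x by simp
  then obtain R where R: "R \<in> approximants P" "linf C le {x, x'} \<in> R"
    using approximants_Union[OF P] by blast
  then have Rp: "R \<in> pts" by (simp add: approximants_def)
  have "x \<in> R" "x' \<in> R"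
    using cp_filtersD(2)[OF Rp R(2)] linf_lower[OF c] c by simp_all
  then have "Q \<subseteq> R" "Q' \<subseteq> R"
    using cp_filtersD(2)[OF Rp] x QC by blast+
  then show "\<exists>R\<in>approximants P. Q \<subseteq> R \<and> Q' \<subseteq> R" using R(1) by blast
qed

lemma approximants_way_below:
  assumes P: "P \<in> pts" and Q: "Q \<in> approximants P"
  shows "way_below pts (\<subseteq>) Q P"
  unfolding way_below_def
proof (intro allI impI)
  fix D s assume D: "directed_on pts (\<subseteq>) D \<and> is_lub pts (\<subseteq>) D s \<and> P \<subseteq> s"
  obtain x where x: "x \<in> P" "\<forall>q\<in>Q. x \<sqsubseteq> q" and QC: "Q \<subseteq> C"
    using Q cp_filtersD(1) unfolding approximants_def by blast
  have "s = \<Union>D" using D directed_pts_lub[of D s] by blast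
  then obtain d where d: "d \<in> D" "x \<in> d" using x(1) D by blast
  then have "d \<in> pts" using D by (auto simp: directed_on_def)
  then have "Q \<subseteq> d" using cp_filtersD(2)[of d x] d(2) x(2) QC by blast
  then show "\<exists>d\<in>D. Q \<subseteq> d" using d(1) by blast
qed

text \<open>The approximants of \<open>P\<close> are way below it, directed, and have union
  \<open>P\<close>, so each point way below \<open>P\<close> is contained in one of them.
  Directedness and supremum therefore pass to the full way-below set.\<close>

lemma continuous_dcpo_pts: "continuous_dcpo pts (\<subseteq>)"
  unfolding continuous_dcpo_def dcpo_on_def
proof (intro conjI allI impI ballI)
  show po: "partial_order_on' pts (\<subseteq>)" by (auto simp: partial_order_on'_def)
  then interpret pts: poset pts "(\<subseteq>)" by unfold_locales
  show "\<exists>x. is_lub pts (\<subseteq>) D x" if "directed_on pts (\<subseteq>) D" for D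
    using directed_pts_lub[OF that] by blast
  fix P assume P: "P \<in> pts"
  let ?W = "{Q \<in> pts. way_below pts (\<subseteq>) Q P}"
  have AW: "approximants P \<subseteq> ?W"
    using approximants_way_below[OF P] by (auto simp: approximants_def)
  have lub: "is_lub pts (\<subseteq>) (approximants P) P"
    using directed_pts_lub[OF approximants_directed[OF P]] approximants_Union[OF P] by simp
  have WA: "\<exists>B\<in>approximants P. Q \<subseteq> B" if "Q \<in> ?W" for Q
    using that approximants_directed[OF P] lub unfolding way_below_def by blast
  show "directed_on pts (\<subseteq>) ?W"
    unfolding directed_on_def
  proof (intro conjI ballI)
    have "approximants P \<noteq> {}" using approximants_directed[OF P] by (simp add: directed_on_def)
    then show "?W \<noteq> {}" using AW by blast
    fix Q Q' assume "Q \<in> ?W" "Q' \<in> ?W"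
    then obtain B B' where B: "B \<in> approximants P" "Q \<subseteq> B" "B' \<in> approximants P" "Q' \<subseteq> B'"
      using WA by blast
    then obtain R where "R \<in> approximants P" "B \<subseteq> R" "B' \<subseteq> R"
      using approximants_directed[OF P] unfolding directed_on_def by blast
    then show "\<exists>R\<in>?W. Q \<subseteq> R \<and> Q' \<subseteq> R"
      using B by (intro bexI[of _ R] subsetD[OF AW] conjI) auto
  qed blast
  show "is_lub pts (\<subseteq>) ?W P"
    unfolding is_lub_def
  proof (intro conjI ballI impI)
    show "Q \<subseteq> P" if "Q \<in> ?W" for Q
      using WA[OF that] approximants_subset[OF P] by (meson subset_trans)
    show "P \<subseteq> R" if "\<forall>Q\<in>?W. Q \<subseteq> R" for R
    proof -
      have "\<Union>(approximants P) \<subseteq> R" using that AW by (meson Union_least subsetD)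
      then show ?thesis by (simp only: approximants_Union[OF P])
    qed
  qed (rule P)
qed

text \<open>Basic open sets are Scott-open because directed suprema are unions. Conversely a
  Scott-open set containing \<open>P\<close> contains an approximant \<open>Q\<close> of
  \<open>P\<close>, and the basic open set of a lower bound of \<open>Q\<close> in \<open>P\<close>
  is a neighbourhood of \<open>P\<close> inside it.\<close>

lemma scott_topology_pts: "scott_topology pts (\<subseteq>) = pt_top C le"
proof (rule topology_eq[THEN iffD2], intro allI iffI)
  fix U assume "openin (pt_top C le) U"
  then obtain u where u: "u \<in> C" "U = eps C le u" using openin_pt_top by blast
  show "openin (scott_topology pts (\<subseteq>)) U"
    unfolding u(2)
  proof (rule openin_scott_topologyI)
    fix D s assume "directed_on pts (\<subseteq>) D" "is_lub pts (\<subseteq>) D s" "s \<in> eps C le u"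
    moreover from this have "s = \<Union>D" using directed_pts_lub by blast
    ultimately show "\<exists>d\<in>D. d \<in> eps C le u" by (auto simp: eps_def directed_on_def)
  qed (auto simp: eps_def)
next
  fix U assume U: "openin (scott_topology pts (\<subseteq>)) U"
  note UD = openin_scott_topologyD[OF U]
  let ?W = "{w\<in>C. eps C le w \<subseteq> U}"
  have W: "?W \<subseteq> C" by blast
  have "\<exists>w\<in>?W. P \<in> eps C le w" if P: "P \<in> U" for P
  proof -
    have Pp: "P \<in> pts" using UD(1) P by blast
    have "is_lub pts (\<subseteq>) (approximants P) P"
      using directed_pts_lub[OF approximants_directed[OF Pp]] approximants_Union[OF Pp] by simp
    then obtain Q where Q: "Q \<in> approximants P" "Q \<in> U"
      using UD(3)[OF approximants_directed[OF Pp]] P by blast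
    then obtain x where x: "x \<in> P" "\<forall>q\<in>Q. x \<sqsubseteq> q" and QC: "Q \<subseteq> C"
      using cp_filtersD(1) unfolding approximants_def by blast
    have "R \<in> U" if R: "R \<in> eps C le x" for R
    proof -
      have "R \<in> pts" "x \<in> R" using R by (auto simp: eps_def)
      then have "Q \<subseteq> R" using cp_filtersD(2)[of R x] x(2) QC by blast
      then show ?thesis using UD(2)[OF Q(2) \<open>R \<in> pts\<close>] by simp
    qed
    moreover have "P \<in> eps C le x" using Pp x by (simp add: eps_def)
    moreover have "x \<in> C" using x(1) cp_filtersD(1)[OF Pp] by blast
    ultimately show ?thesis by blast
  qed
  then have "U = eps C le (lsup C le ?W)" unfolding eps_lsup[OF W] by blast
  then show "openin (pt_top C le) U" using lsup_closed[OF W] openin_pt_top by blast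
qed

end

text \<open>Both categories in each pair are full, so the adjunction restricts to an equivalence as
  soon as each functor carries objects of one class into the other and unit and counit are
  isomorphisms there. Each conjunct states this for one functor. \<open>frame_iso\<close> and
  \<open>homeomorphic_space\<close> express that both classes are taken up to isomorphism.\<close>

theorem theorem11p1:
  shows
  \<comment> \<open>LCS-complete spaces: unit iso, and O(X) is one of the quotient frames\<close>
  "(\<forall>(X::'a topology) (Y::'b topology) S.
      lc_sober Y \<and> gdelta_in Y S \<and> X homeomorphic_space subtopology Y S \<longrightarrow>
      homeomorphic_map X (pt_top (opens X) (\<subseteq>)) (eta X) \<and>
      (\<exists>(C::'b set set) le A. complete_lattice_on C le \<and> distributive_on C le \<and>
          continuous_lattice C le \<and> A \<subseteq> C \<and> countable A \<and>
          (\<exists>f. frame_iso (opens X) (\<subseteq>)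
                 (quot_carrier C (prec_A C le A)) (quot_le (prec_A C le A)) f)))
   \<and>
   \<comment> \<open>quotients of distributive continuous complete lattices: counit iso, pt is LCS-complete\<close>
   (\<forall>(C::'l set) le A. complete_lattice_on C le \<and> distributive_on C le \<and>
      continuous_lattice C le \<and> A \<subseteq> C \<and> countable A \<longrightarrow>
      frame_iso (quot_carrier C (prec_A C le A)) (quot_le (prec_A C le A))
         (opens (pt_top (quot_carrier C (prec_A C le A)) (quot_le (prec_A C le A)))) (\<subseteq>)
         (eps (quot_carrier C (prec_A C le A)) (quot_le (prec_A C le A))) \<and>
      (\<exists>(Y::'l set topology) S. lc_sober Y \<and> gdelta_in Y S \<and>
         pt_top (quot_carrier C (prec_A C le A)) (quot_le (prec_A C le A))
           homeomorphic_space subtopology Y S))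
   \<and>
   \<comment> \<open>domain-complete spaces\<close>
   (\<forall>(X::'a topology) (D::'b set) leD S.
      continuous_dcpo D leD \<and> gdelta_in (scott_topology D leD) S \<and>
      X homeomorphic_space subtopology (scott_topology D leD) S \<longrightarrow>
      homeomorphic_map X (pt_top (opens X) (\<subseteq>)) (eta X) \<and>
      (\<exists>(C::'b set set) le A. complete_lattice_on C le \<and> completely_distributive_on C le \<and>
          continuous_lattice C le \<and> A \<subseteq> C \<and> countable A \<and>
          (\<exists>f. frame_iso (opens X) (\<subseteq>)
                 (quot_carrier C (prec_A C le A)) (quot_le (prec_A C le A)) f)))
   \<and>
   \<comment> \<open>quotients of completely distributive continuous complete lattices\<close>
   (\<forall>(C::'l set) le A. complete_lattice_on C le \<and> completely_distributive_on C le \<and>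
      continuous_lattice C le \<and> A \<subseteq> C \<and> countable A \<longrightarrow>
      frame_iso (quot_carrier C (prec_A C le A)) (quot_le (prec_A C le A))
         (opens (pt_top (quot_carrier C (prec_A C le A)) (quot_le (prec_A C le A)))) (\<subseteq>)
         (eps (quot_carrier C (prec_A C le A)) (quot_le (prec_A C le A))) \<and>
      (\<exists>(E::'l set set) leE S. continuous_dcpo E leE \<and> gdelta_in (scott_topology E leE) S \<and>
         pt_top (quot_carrier C (prec_A C le A)) (quot_le (prec_A C le A))
           homeomorphic_space subtopology (scott_topology E leE) S))"
proof (intro conjI allI impI)
  fix X :: "'a topology" and Y :: "'b topology" and S
  assume H: "lc_sober Y \<and> gdelta_in Y S \<and> X homeomorphic_space subtopology Y S"
  have cont: "continuous_lattice (opens Y) (\<subseteq>)"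
    using H by (intro locally_compact_continuous_lattice) (simp add: lc_sober_def)
  have cl: "complete_lattice_on (opens Y) (\<subseteq>)" using clat_opens clat_iff by blast
  have sob: "sober_space Y" using H by (simp add: lc_sober_def)
  note * = gdelta_subspace_frame[OF sob _ _ cont, of S X]
  show "homeomorphic_map X (pt_top (opens X) (\<subseteq>)) (eta X)" using H *(1) by simp
  obtain A where "A \<subseteq> opens Y" "countable A" "\<exists>f. frame_iso (opens X) (\<subseteq>)
      (quot_carrier (opens Y) (prec_A (opens Y) (\<subseteq>) A)) (quot_le (prec_A (opens Y) (\<subseteq>) A)) f"
    using H *(2) by blast
  then show "\<exists>(C::'b set set) le A. complete_lattice_on C le \<and> distributive_on C le \<and>
          continuous_lattice C le \<and> A \<subseteq> C \<and> countable A \<and>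
          (\<exists>f. frame_iso (opens X) (\<subseteq>)
                 (quot_carrier C (prec_A C le A)) (quot_le (prec_A C le A)) f)"
    using cl cont opens_distributive
    by (intro exI[of _ "opens Y"] exI[of _ "(\<subseteq>)"] exI[of _ A] conjI)
next
  fix C :: "'l set" and le A
  assume H: "complete_lattice_on C le \<and> distributive_on C le \<and>
      continuous_lattice C le \<and> A \<subseteq> C \<and> countable A"
  then interpret clat C le using clat_iff by blast
  show "frame_iso (quot_carrier C (prec_A C le A)) (quot_le (prec_A C le A))
         (opens (pt_top (quot_carrier C (prec_A C le A)) (quot_le (prec_A C le A)))) (\<subseteq>)
         (eps (quot_carrier C (prec_A C le A)) (quot_le (prec_A C le A)))"
    using H by (intro eps_frame_iso_quotient) simp_all
  show "\<exists>(Y::'l set topology) S. lc_sober Y \<and> gdelta_in Y S \<and>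
         pt_top (quot_carrier C (prec_A C le A)) (quot_le (prec_A C le A))
           homeomorphic_space subtopology Y S"
    using lc_sober_pt_top gdelta_points_containing pt_quotient_homeomorphic H by blast
next
  fix X :: "'a topology" and D :: "'b set" and leD S
  assume H: "continuous_dcpo D leD \<and> gdelta_in (scott_topology D leD) S \<and>
      X homeomorphic_space subtopology (scott_topology D leD) S"
  then interpret cont_dcpo D leD using cont_dcpo_iff by blast
  let ?Y = "scott_topology D leD"
  have cl: "complete_lattice_on (opens ?Y) (\<subseteq>)" using clat_opens clat_iff by blast
  note * = gdelta_subspace_frame[OF scott_sober _ _ scott_opens_continuous, of S X]
  show "homeomorphic_map X (pt_top (opens X) (\<subseteq>)) (eta X)" using H *(1) by simp
  obtain A where "A \<subseteq> opens ?Y" "countable A" "\<exists>f. frame_iso (opens X) (\<subseteq>)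
      (quot_carrier (opens ?Y) (prec_A (opens ?Y) (\<subseteq>) A)) (quot_le (prec_A (opens ?Y) (\<subseteq>) A)) f"
    using H *(2) by blast
  then show "\<exists>(C::'b set set) le A. complete_lattice_on C le \<and> completely_distributive_on C le \<and>
          continuous_lattice C le \<and> A \<subseteq> C \<and> countable A \<and>
          (\<exists>f. frame_iso (opens X) (\<subseteq>)
                 (quot_carrier C (prec_A C le A)) (quot_le (prec_A C le A)) f)"
    using cl scott_opens_continuous scott_opens_completely_distributive
    by (intro exI[of _ "opens ?Y"] exI[of _ "(\<subseteq>)"] exI[of _ A] conjI)
next
  fix C :: "'l set" and le A
  assume H: "complete_lattice_on C le \<and> completely_distributive_on C le \<and>
      continuous_lattice C le \<and> A \<subseteq> C \<and> countable A"
  then interpret clat C le using clat_iff by blast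
  interpret cd_lattice C le using H by unfold_locales simp
  show "frame_iso (quot_carrier C (prec_A C le A)) (quot_le (prec_A C le A))
         (opens (pt_top (quot_carrier C (prec_A C le A)) (quot_le (prec_A C le A)))) (\<subseteq>)
         (eps (quot_carrier C (prec_A C le A)) (quot_le (prec_A C le A)))"
    using H distributive by (intro eps_frame_iso_quotient) simp_all
  \<comment> \<open>Since the Scott topology on the points is the spectral one, the same
    \<open>G_delta\<close> set as in the distributive case serves here.\<close>
  have "gdelta_in (scott_topology pts (\<subseteq>)) {P \<in> pts. A \<subseteq> P}"
    "pt_top (quot_carrier C (prec_A C le A)) (quot_le (prec_A C le A))
       homeomorphic_space subtopology (scott_topology pts (\<subseteq>)) {P \<in> pts. A \<subseteq> P}"
    using gdelta_points_containing pt_quotient_homeomorphic H unfolding scott_topology_pts by blast+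
  then show "\<exists>(E::'l set set) leE S. continuous_dcpo E leE \<and> gdelta_in (scott_topology E leE) S \<and>
         pt_top (quot_carrier C (prec_A C le A)) (quot_le (prec_A C le A))
           homeomorphic_space subtopology (scott_topology E leE) S"
    using continuous_dcpo_pts by blast
qed

end
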